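(* Let $f$ be a pseudo-polynomial. There exist an exponent $\eta>0$ and a constant $C>0$, both depending only on $f$, such that for every real number $\xi$ and every sufficiently large $N\in\mathbb{N}$, \[\min_{1\le n\le N}\lVert\xi\lfloor f(n)\rfloor\rVert\le C N^{-\eta}.\]
   Context: A pseudo-polynomial is a function $f(x)=\alpha_1x^{\theta_1}+\cdots+\alpha_dx^{\theta_d}$ where $\alpha_1,\dots,\alpha_d,\theta_1,\dots,\theta_d$ are positive reals with $1\le\theta_1<\cdots<\theta_d$ and at least one $\theta_j\notin\mathbb{Z}$. $\lVert x\rVert$ denotes the distance from $x$ to the nearest integer, and $\lfloor\cdot\rfloor$ the floor function. *)

theory Defs
  imports "HOL-Analysis.Analysis"
begin

definition dist_nint :: "real \<Rightarrow> real" where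
  "dist_nint x = (INF k\<in>(\<int>::real set). \<bar>x - k\<bar>)"

definition pseudo_poly :: "nat \<Rightarrow> (nat \<Rightarrow> real) \<Rightarrow> (nat \<Rightarrow> real) \<Rightarrow> bool" where
  "pseudo_poly d \<alpha> \<theta> \<longleftrightarrow> d \<ge> 1 \<and> (\<forall>i\<in>{1..d}. \<alpha> i > 0) \<and> \<theta> 1 \<ge> 1 \<and>
     (\<forall>i\<in>{1..d}. \<forall>j\<in>{1..d}. i < j \<longrightarrow> \<theta> i < \<theta> j) \<and> (\<exists>j\<in>{1..d}. \<theta> j \<notin> \<int>)"

definition pp_eval :: "nat \<Rightarrow> (nat \<Rightarrow> real) \<Rightarrow> (nat \<Rightarrow> real) \<Rightarrow> real \<Rightarrow> real" where
  "pp_eval d \<alpha> \<theta> x = (\<Sum>i=1..d. \<alpha> i * x powr \<theta> i)"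

end

theory Submission
  imports Defs "HOL-Real_Asymp.Real_Asymp"
begin

text \<open>
  Let \<open>f\<close> be the pseudo-polynomial and \<open>t\<close> its largest non-integral exponent. On short blocks, \<open>f\<close>
  agrees up to a small error with its Taylor polynomial of a fixed degree \<open>k > 2 \<theta>\<^sub>d\<close>, whose
  top coefficient is governed by \<open>x powr (t - k)\<close> because the integral exponents do not contribute.
  Weyl differencing then saves a power of \<open>N\<close> in \<open>\<Sum>n=N..<2N. e(\<beta> f(n))\<close>, uniformly for
  \<open>N powr (- \<sigma>) \<le> \<bar>\<beta>\<bar> \<le> N powr \<sigma>\<close>. We may take \<open>0 \<le> \<xi> < 1\<close>. If \<open>\<xi> b\<close> is not very close to an integer
  for any positive \<open>b\<close> below some bound \<open>H\<close>, then all frequencies \<open>a + b \<xi>\<close> with \<open>\<bar>a\<bar>, \<bar>b\<bar> < H\<close> not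
  both zero lie in that range, so \<open>(f(n), \<xi> f(n))\<close> comes close to \<open>(0+, 0)\<close> modulo 1 and \<open>\<xi> \<lfloor>f(n)\<rfloor>\<close>
  is close to an integer. Otherwise \<open>\<xi> b\<close> is very close to an integer for some small \<open>b\<close>, and it
  suffices to find a much smaller \<open>n\<close> such that \<open>b\<close> divides \<open>\<lfloor>f(n)\<rfloor>\<close>, which again follows from the
  bound on exponential sums.
\<close>

section \<open>Distance to the nearest integer\<close>

lemma dist_nint_le: "dist_nint x \<le> \<bar>x - of_int m\<bar>"
  unfolding dist_nint_def by (rule cINF_lower) (auto intro!: bdd_belowI[of _ 0])

lemma dist_nint_eq_round: "dist_nint x = \<bar>x - of_int (round x)\<bar>"
proof (rule antisym)
  show "\<bar>x - of_int (round x)\<bar> \<le> dist_nint x"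
    unfolding dist_nint_def
    by (rule cINF_greatest) (auto simp: round_diff_minimal elim!: Ints_cases)
qed (rule dist_nint_le)

lemma dist_nint_nonneg: "0 \<le> dist_nint x"
  by (simp add: dist_nint_eq_round)

lemma dist_nint_eq_abs:
  assumes "\<bar>x\<bar> \<le> 1 / 2"
  shows "dist_nint x = \<bar>x\<bar>"
proof (rule antisym)
  have "\<bar>x\<bar> \<le> \<bar>x - of_int m\<bar>" for m
  proof (cases "m = 0")
    case False
    then have "1 \<le> \<bar>real_of_int m\<bar>" by linarith
    then show ?thesis using assms by linarith
  qed simp
  then show "\<bar>x\<bar> \<le> dist_nint x"
    by (simp add: dist_nint_eq_round)
qed (use dist_nint_le[of x 0] in simp)

lemma dist_nint_add_of_int: "dist_nint (x + of_int m) = dist_nint x"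
proof -
  have add_le: "dist_nint (y + of_int k) \<le> dist_nint y" for y k
    using dist_nint_le[of "y + of_int k" "round y + k"] by (simp add: dist_nint_eq_round)
  show ?thesis
    using add_le[of x m] add_le[of "x + of_int m" "- m"] by simp
qed

lemma dist_nint_frac_mult_of_int: "dist_nint (frac x * of_int m) = dist_nint (x * of_int m)"
  using dist_nint_add_of_int[of "frac x * of_int m" "\<lfloor>x\<rfloor> * m"] by (simp add: frac_def algebra_simps)

lemma dist_nint_add_le: "dist_nint (x + y) \<le> dist_nint x + \<bar>y\<bar>"
  using dist_nint_le[of "x + y" "round x"] unfolding dist_nint_eq_round[of x] by linarith

lemma dist_nint_mult_of_int_le: "dist_nint (x * of_int m) \<le> dist_nint x * \<bar>of_int m\<bar>"
  using dist_nint_le[of "x * of_int m" "round x * m"]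
  by (simp add: dist_nint_eq_round[of x] flip: abs_mult left_diff_distrib)

lemma frac_less_if_dist_nint_diff_less:
  assumes "dist_nint (x - \<delta>) < \<delta>" "\<delta> \<le> 1 / 2"
  shows "frac x < 2 * \<delta>"
proof -
  define m where "m = round (x - \<delta>)"
  have "of_int m < x" "x < of_int m + 2 * \<delta>"
    using assms(1) unfolding dist_nint_eq_round m_def by linarith+
  moreover from this have "\<lfloor>x\<rfloor> = m"
    using assms(2) by (intro floor_unique) auto
  ultimately show ?thesis
    by (simp add: frac_def)
qed

lemma dvd_floor_if_frac_divide_less:
  fixes b :: nat
  assumes "b > 0" "frac (x / real b) < 1 / real b"
  shows "int b dvd \<lfloor>x\<rfloor>"
proof -
  have decomposition: "x = real b * of_int \<lfloor>x / real b\<rfloor> + real b * frac (x / real b)"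
    using assms(1) by (simp add: frac_def flip: distrib_left)
  have "0 \<le> real b * frac (x / real b)" "real b * frac (x / real b) < 1"
    using assms by (simp_all add: field_simps)
  with decomposition have "real b * of_int \<lfloor>x / real b\<rfloor> \<le> x" "x < real b * of_int \<lfloor>x / real b\<rfloor> + 1"
    by linarith+
  then have "\<lfloor>x\<rfloor> = int b * \<lfloor>x / real b\<rfloor>"
    by (intro floor_unique) simp_all
  then show ?thesis by simp
qed

section \<open>Exponential sums and Weyl differencing\<close>

definition cis2pi :: "real \<Rightarrow> complex" where
  "cis2pi x = cis (2 * pi * x)"

lemma norm_cis2pi [simp]: "norm (cis2pi x) = 1"
  by (simp add: cis2pi_def)

lemma cis2pi_0 [simp]: "cis2pi 0 = 1"
  by (simp add: cis2pi_def)

lemma cis2pi_add: "cis2pi (x + y) = cis2pi x * cis2pi y"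
  by (simp add: cis2pi_def cis_mult distrib_left)

lemma cnj_cis2pi: "cnj (cis2pi x) = cis2pi (- x)"
  by (simp add: cis2pi_def cis_cnj)

lemma cis2pi_of_nat_mult: "cis2pi (real n * x) = cis2pi x ^ n"
  by (induction n) (simp_all add: distrib_right cis2pi_add)

lemma cis2pi_sum: "finite A \<Longrightarrow> cis2pi (\<Sum>i\<in>A. x i) = (\<Prod>i\<in>A. cis2pi (x i))"
  by (induction rule: finite_induct) (simp_all add: cis2pi_add)

lemma norm_cis2pi_minus_1: "norm (cis2pi x - 1) = 2 * \<bar>sin (pi * x)\<bar>"
  using dist_exp_i_1[of "2 * pi * x"] by (simp add: cis2pi_def cis_conv_exp)

lemma norm_cis2pi_diff_le: "norm (cis2pi x - cis2pi y) \<le> 2 * pi * \<bar>x - y\<bar>"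
proof -
  have "cis2pi x - cis2pi y = cis2pi y * (cis2pi (x - y) - 1)"
    using cis2pi_add[of y "x - y"] by (simp add: algebra_simps)
  then have "norm (cis2pi x - cis2pi y) = 2 * \<bar>sin (pi * (x - y))\<bar>"
    by (simp add: norm_mult norm_cis2pi_minus_1)
  also have "\<dots> \<le> 2 * \<bar>pi * (x - y)\<bar>"
    by (intro mult_left_mono abs_sin_x_le_abs_x) simp
  finally show ?thesis by (simp add: abs_mult)
qed

lemma two_mult_le_sin_pi:
  fixes x :: real
  assumes "0 \<le> x" "x \<le> 1 / 2"
  shows "2 * x \<le> sin (pi * x)"
proof -
  have "convex_on {0..pi} (\<lambda>x::real. - sin x)"
  proof (rule f''_ge0_imp_convex)
    show "((\<lambda>x. - sin x) has_real_derivative - cos x) (at x)"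
      and "((\<lambda>x. - cos x) has_real_derivative sin x) (at x)" for x :: real
      by (auto intro!: derivative_eq_intros)
    show "0 \<le> sin x" if "x \<in> {0..pi}" for x :: real
      using that by (auto intro: sin_ge_zero)
  qed auto
  from convex_onD[OF this, of "2 * x" 0 "pi / 2"] show ?thesis
    using assms by (simp add: mult_ac)
qed

lemma norm_cis2pi_minus_1_ge: "4 * dist_nint x \<le> norm (cis2pi x - 1)"
proof -
  define r where "r = x - of_int (round x)"
  have "cis2pi x = cis2pi r * cis2pi (of_int (round x))"
    by (simp add: r_def flip: cis2pi_add)
  also have "cis2pi (of_int (round x)) = 1"
    by (simp add: cis2pi_def)
  finally have "norm (cis2pi x - 1) = 2 * \<bar>sin (pi * r)\<bar>"
    using norm_cis2pi_minus_1[of r] by simp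
  also have "\<bar>sin (pi * r)\<bar> = \<bar>sin (pi * \<bar>r\<bar>)\<bar>"
    by (cases "r \<ge> 0") auto
  also have "2 * \<dots> \<ge> 2 * (2 * \<bar>r\<bar>)"
    using two_mult_le_sin_pi[of "\<bar>r\<bar>"] of_int_round_abs_le[of x]
    by (simp add: r_def abs_minus_commute)
  finally show ?thesis
    by (simp add: dist_nint_eq_round r_def)
qed

lemma dist_nint_mult_norm_sum_cis2pi_le:
  "dist_nint c * norm (\<Sum>h<n. cis2pi (a + real h * c)) \<le> 1 / 2"
proof -
  have "(\<Sum>h<n. cis2pi (a + real h * c)) = cis2pi a * (\<Sum>h<n. cis2pi c ^ h)"
    by (simp add: cis2pi_add cis2pi_of_nat_mult sum_distrib_left)
  then have "4 * dist_nint c * norm (\<Sum>h<n. cis2pi (a + real h * c)) =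
      4 * dist_nint c * norm (\<Sum>h<n. cis2pi c ^ h)"
    by (simp add: norm_mult)
  also have "\<dots> \<le> norm (cis2pi c - 1) * norm (\<Sum>h<n. cis2pi c ^ h)"
    by (intro mult_right_mono norm_cis2pi_minus_1_ge) simp
  also have "\<dots> = norm (cis2pi c ^ n - 1)"
    by (simp add: power_diff_1_eq flip: norm_mult)
  also have "\<dots> \<le> 2"
    using norm_triangle_ineq4[of "cis2pi c ^ n" 1] by (simp add: norm_power)
  finally show ?thesis by simp
qed

lemma norm_sum_cis2pi_perturb:
  assumes "\<And>h. h \<in> A \<Longrightarrow> \<bar>x h - y h\<bar> \<le> E"
  shows "norm (\<Sum>h\<in>A. cis2pi (x h)) \<le> norm (\<Sum>h\<in>A. cis2pi (y h)) + real (card A) * (2 * pi * E)"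
proof -
  have "norm ((\<Sum>h\<in>A. cis2pi (x h)) - (\<Sum>h\<in>A. cis2pi (y h))) \<le> (\<Sum>h\<in>A. 2 * pi * E)"
    unfolding sum_subtractf[symmetric]
  proof (rule sum_norm_le)
    fix h assume "h \<in> A"
    then show "norm (cis2pi (x h) - cis2pi (y h)) \<le> 2 * pi * E"
      by (intro order_trans[OF norm_cis2pi_diff_le] mult_left_mono assms) auto
  qed
  then show ?thesis
    using norm_triangle_sub[of "\<Sum>h\<in>A. cis2pi (x h)" "\<Sum>h\<in>A. cis2pi (y h)"] by simp
qed

lemma norm_sum_sq_eq_correlations:
  fixes u :: "nat \<Rightarrow> complex"
  shows "(norm (\<Sum>h<n. u h))\<^sup>2 = (\<Sum>h<n. (norm (u h))\<^sup>2) +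
    2 * Re (\<Sum>r=1..<n. \<Sum>h<n-r. u (h + r) * cnj (u h))"
proof (induction n)
  case (Suc n)
  let ?S = "\<Sum>h<n. u h"
  have "(\<Sum>r=1..<Suc n. \<Sum>h<Suc n-r. u (h + r) * cnj (u h)) =
      (\<Sum>r=1..<Suc n. (\<Sum>h<n-r. u (h + r) * cnj (u h)) + u n * cnj (u (n - r)))"
    by (rule sum.cong) (auto simp: Suc_diff_le)
  also have "\<dots> = (\<Sum>r=1..<Suc n. \<Sum>h<n-r. u (h + r) * cnj (u h)) +
      (\<Sum>r=1..<Suc n. u n * cnj (u (n - r)))"
    by (rule sum.distrib)
  also have "(\<Sum>r=1..<Suc n. \<Sum>h<n-r. u (h + r) * cnj (u h)) =
      (\<Sum>r=1..<n. \<Sum>h<n-r. u (h + r) * cnj (u h))"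
    by (cases n) auto
  also have "(\<Sum>r=1..<Suc n. u n * cnj (u (n - r))) = (\<Sum>h<n. u n * cnj (u h))"
    by (rule sum.reindex_bij_witness[of _ "\<lambda>h. n - h" "\<lambda>r. n - r"]) auto
  finally have correlations_Suc: "(\<Sum>r=1..<Suc n. \<Sum>h<Suc n-r. u (h + r) * cnj (u h)) =
      (\<Sum>r=1..<n. \<Sum>h<n-r. u (h + r) * cnj (u h)) + u n * cnj ?S"
    by (simp add: sum_distrib_left)
  have "(norm (z + w))\<^sup>2 = (norm z)\<^sup>2 + (norm w)\<^sup>2 + 2 * Re (w * cnj z)" for z w
    unfolding cmod_power2 by (simp add: power2_eq_square algebra_simps)
  from this[of ?S "u n"] have "(norm (\<Sum>h<Suc n. u h))\<^sup>2 =
      (norm ?S)\<^sup>2 + (norm (u n))\<^sup>2 + 2 * Re (u n * cnj ?S)"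
    by simp
  with Suc.IH show ?case
    unfolding correlations_Suc by (simp only: sum.lessThan_Suc plus_complex.sel distrib_left)
qed auto

lemma van_der_corput_ineq:
  fixes u :: "nat \<Rightarrow> real"
  shows "(norm (\<Sum>h<n. cis2pi (u h)))\<^sup>2 \<le>
    real n + 2 * (\<Sum>r=1..<n. norm (\<Sum>h<n-r. cis2pi (u (h + r) - u h)))"
proof -
  have "(norm (\<Sum>h<n. cis2pi (u h)))\<^sup>2 =
      real n + 2 * Re (\<Sum>r=1..<n. \<Sum>h<n-r. cis2pi (u (h + r)) * cnj (cis2pi (u h)))"
    by (simp only: norm_sum_sq_eq_correlations) simp
  also have "(\<Sum>r=1..<n. \<Sum>h<n-r. cis2pi (u (h + r)) * cnj (cis2pi (u h))) =
      (\<Sum>r=1..<n. \<Sum>h<n-r. cis2pi (u (h + r) - u h))"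
    by (simp add: cnj_cis2pi flip: cis2pi_add)
  also have "Re \<dots> \<le> norm \<dots>"
    by (rule complex_Re_le_cmod)
  also have "\<dots> \<le> (\<Sum>r=1..<n. norm (\<Sum>h<n-r. cis2pi (u (h + r) - u h)))"
    by (rule norm_sum)
  finally show ?thesis by simp
qed

lemma sum_le_split_at_threshold:
  fixes T :: "nat \<Rightarrow> real"
  assumes "0 \<le> y" "0 \<le> K" "0 \<le> B"
    and "\<And>r. r \<in> {1..<n} \<Longrightarrow> real r < y \<Longrightarrow> T r \<le> K"
    and "\<And>r. r \<in> {1..<n} \<Longrightarrow> y \<le> real r \<Longrightarrow> T r \<le> B"
  shows "(\<Sum>r=1..<n. T r) \<le> y * K + real n * B"
proof -
  have "{r \<in> {1..<n}. real r < y} \<subseteq> {1..nat \<lfloor>y\<rfloor>}"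
    by (auto simp: le_nat_floor)
  then have "card {r \<in> {1..<n}. real r < y} \<le> nat \<lfloor>y\<rfloor>"
    using card_mono[of "{1..nat \<lfloor>y\<rfloor>}"] by fastforce
  moreover have "real (nat \<lfloor>y\<rfloor>) \<le> y"
    using assms(1) by simp
  ultimately have card_le: "real (card {r \<in> {1..<n}. real r < y}) \<le> y"
    by linarith
  have "(\<Sum>r=1..<n. T r) \<le> (\<Sum>r=1..<n. (if real r < y then K else 0) + B)"
    using assms by (intro sum_mono) (auto simp: not_less add_increasing2)
  also have "\<dots> = real (card {r \<in> {1..<n}. real r < y}) * K + real (n - 1) * B"
    by (simp add: sum.distrib sum.If_cases Int_def)
  also have "\<dots> \<le> y * K + real n * B"
    using card_le assms by (intro add_mono mult_right_mono) auto
  finally show ?thesis .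
qed

lemma weyl_differencing:
  assumes "n \<le> H" "0 \<le> y" "0 \<le> B"
    and shifted: "\<And>r. r \<in> {1..<n} \<Longrightarrow> y \<le> real r \<Longrightarrow> norm (\<Sum>h<n-r. cis2pi (P (h + r) - P h)) \<le> B"
  shows "(norm (\<Sum>h<n. cis2pi (P h)))\<^sup>2 \<le> real H + 2 * real H * (y + B)"
proof -
  define T where "T r = norm (\<Sum>h<n-r. cis2pi (P (h + r) - P h))" for r
  have "T r \<le> real H" for r
    unfolding T_def using assms(1) by (intro order_trans[OF norm_sum]) simp
  then have "(\<Sum>r=1..<n. T r) \<le> y * real H + real n * B"
    using assms(2,3) shifted by (intro sum_le_split_at_threshold) (auto simp: T_def)
  also have "\<dots> \<le> y * real H + real H * B"
    using assms by (intro add_left_mono mult_right_mono) auto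
  finally have "(\<Sum>r=1..<n. T r) \<le> real H * (y + B)"
    by (simp add: algebra_simps)
  with van_der_corput_ineq[of P n] show ?thesis
    using assms(1) unfolding T_def by (simp add: mult.assoc)
qed

text \<open>For a polynomial of degree at most \<open>k\<close>, \<open>c\<close> is \<open>k!\<close> times its \<open>k\<close>-th coefficient.\<close>
primrec top_difference :: "nat \<Rightarrow> real \<Rightarrow> (nat \<Rightarrow> real) \<Rightarrow> bool" where
  "top_difference 0 c P \<longleftrightarrow> (\<forall>n. P n = c)"
| "top_difference (Suc k) c P \<longleftrightarrow> (\<forall>r. top_difference k (real r * c) (\<lambda>n. P (n + r) - P n))"

lemma top_difference_add:
  "top_difference k a P \<Longrightarrow> top_difference k b Q \<Longrightarrow> top_difference k (a + b) (\<lambda>n. P n + Q n)"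
proof (induction k arbitrary: a b P Q)
  case (Suc k)
  have "top_difference k (real r * a + real r * b)
      (\<lambda>n. (P (n + r) - P n) + (Q (n + r) - Q n))" for r
    using Suc by simp
  then show ?case by (simp add: algebra_simps)
qed auto

lemma top_difference_cmult: "top_difference k a P \<Longrightarrow> top_difference k (b * a) (\<lambda>n. b * P n)"
proof (induction k arbitrary: a P)
  case (Suc k)
  have "top_difference k (b * (real r * a)) (\<lambda>n. b * (P (n + r) - P n))" for r
    using Suc by simp
  then show ?case by (simp add: algebra_simps)
qed auto

lemma top_difference_zero: "top_difference k 0 (\<lambda>_. 0)"
  by (induction k) auto

lemma top_difference_sum:
  assumes "finite I" "\<And>i. i \<in> I \<Longrightarrow> top_difference k (a i) (P i)"
  shows "top_difference k (\<Sum>i\<in>I. a i) (\<lambda>n. \<Sum>i\<in>I. P i n)"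
  using assms by (induction rule: finite_induct)
    (auto intro: top_difference_zero top_difference_add)

lemma top_difference_power:
  "j \<le> k \<Longrightarrow> top_difference k (if j = k then fact k else 0) (\<lambda>n. real n ^ j)"
proof (induction k arbitrary: j)
  case (Suc k)
  have "top_difference k (real r * (if j = Suc k then fact (Suc k) else 0))
      (\<lambda>n. real (n + r) ^ j - real n ^ j)" for r
  proof -
    have "(\<Sum>i<j. (real (j choose i) * real r ^ (j - i)) * (if i = k then fact k else 0)) =
        real r * (if j = Suc k then fact (Suc k) else 0)"
      using Suc.prems by (auto simp: if_distrib sum.delta cong: if_cong)
    moreover have "top_difference k
        (\<Sum>i<j. (real (j choose i) * real r ^ (j - i)) * (if i = k then fact k else 0))
        (\<lambda>n. \<Sum>i<j. (real (j choose i) * real r ^ (j - i)) * real n ^ i)"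
      using Suc by (intro top_difference_sum top_difference_cmult) auto
    moreover have "(\<lambda>n. \<Sum>i<j. (real (j choose i) * real r ^ (j - i)) * real n ^ i) =
        (\<lambda>n. real (n + r) ^ j - real n ^ j)"
      by (rule ext) (simp add: binomial_ring lessThan_Suc_atMost[symmetric] mult_ac)
    ultimately show ?thesis by simp
  qed
  then show ?case unfolding top_difference.simps by blast
qed auto

lemma top_difference_poly:
  "top_difference k (fact k * a k) (\<lambda>n. \<Sum>j\<le>k. a j * real n ^ j)"
proof -
  have "top_difference k (\<Sum>j\<le>k. a j * (if j = k then fact k else 0))
      (\<lambda>n. \<Sum>j\<le>k. a j * real n ^ j)"
    by (intro top_difference_sum top_difference_cmult top_difference_power) auto
  also have "(\<Sum>j\<le>k. a j * (if j = k then fact k else 0)) = fact k * a k"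
    by (simp add: if_distrib sum.delta cong: if_cong)
  finally show ?thesis .
qed

definition weyl_estimate :: "nat \<Rightarrow> real \<Rightarrow> real \<Rightarrow> bool" where
  "weyl_estimate k C \<sigma> \<longleftrightarrow> (\<forall>c P H n. top_difference (Suc k) c P \<longrightarrow> n \<le> H \<longrightarrow>
     \<bar>c\<bar> * real H ^ k \<le> 1 / 2 \<longrightarrow> 1 \<le> \<bar>c\<bar> * real H ^ Suc k \<longrightarrow>
     norm (\<Sum>h<n. cis2pi (P h)) \<le> C * real H * (\<bar>c\<bar> * real H ^ Suc k) powr (- \<sigma>))"

lemma weyl_estimateD:
  assumes "weyl_estimate k C \<sigma>" "top_difference (Suc k) c P" "n \<le> H"
    "\<bar>c\<bar> * real H ^ k \<le> 1 / 2" "1 \<le> \<bar>c\<bar> * real H ^ Suc k"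
  shows "norm (\<Sum>h<n. cis2pi (P h)) \<le> C * real H * (\<bar>c\<bar> * real H ^ Suc k) powr (- \<sigma>)"
  using assms unfolding weyl_estimate_def by blast

lemma weyl_estimate_0: "weyl_estimate 0 1 1"
  unfolding weyl_estimate_def
proof (intro allI impI)
  fix c P H n
  assume differences: "top_difference (Suc 0) c P" and "\<bar>c\<bar> * real H ^ 0 \<le> 1 / 2"
    and large: "1 \<le> \<bar>c\<bar> * real H ^ Suc 0"
  then have c_eq: "c \<noteq> 0" "dist_nint c = \<bar>c\<bar>"
    by (auto intro: dist_nint_eq_abs)
  have "P h = P 0 + real h * c" for h
  proof -
    have "P (0 + h) - P 0 = real h * c"
      using differences unfolding top_difference.simps by blast
    then show ?thesis by simp
  qed
  then have "norm (\<Sum>h<n. cis2pi (P h)) = norm (\<Sum>h<n. cis2pi (P 0 + real h * c))"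
    by metis
  also have "\<dots> \<le> 1 / \<bar>c\<bar>"
    using dist_nint_mult_norm_sum_cis2pi_le[of c "P 0" n] c_eq by (simp add: field_simps)
  also have "\<dots> = 1 * real H * (\<bar>c\<bar> * real H ^ Suc 0) powr (- 1)"
    using large c_eq by (cases "H = 0") (auto simp: powr_minus_divide)
  finally show "norm (\<Sum>h<n. cis2pi (P h)) \<le> 1 * real H * (\<bar>c\<bar> * real H ^ Suc 0) powr (- 1)" .
qed

lemma weyl_estimate_difference:
  assumes weyl: "weyl_estimate k C \<sigma>" and nonneg: "0 \<le> C" "0 \<le> \<sigma>"
    and differences: "top_difference (Suc (Suc k)) c P" and "n \<le> H" "r \<le> H"
    and small: "\<bar>c\<bar> * real H ^ Suc k \<le> 1 / 2"
    and X_eq: "X = \<bar>c\<bar> * real H ^ Suc (Suc k)" and X_ge_1: "1 \<le> X"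
    and r_large: "real H * X powr (- (1 / 2)) \<le> real r"
  shows "norm (\<Sum>h<n. cis2pi (P (h + r) - P h)) \<le> C * real H * X powr (- (\<sigma> / 2))"
proof -
  define X' where "X' = \<bar>real r * c\<bar> * real H ^ Suc k"
  have "X powr (1/2) = X * X powr (- (1 / 2))"
    using X_ge_1 by (simp add: powr_mult_base)
  also have "\<dots> = \<bar>c\<bar> * real H ^ Suc k * (real H * X powr (- (1 / 2)))"
    by (simp add: X_eq mult_ac)
  also have "\<dots> \<le> \<bar>c\<bar> * real H ^ Suc k * real r"
    using r_large by (intro mult_left_mono) auto
  also have "\<dots> = X'" by (simp add: X'_def abs_mult mult_ac)
  finally have sqrt_le: "X powr (1/2) \<le> X'" .
  have sqrt_ge_1: "1 \<le> X powr (1/2)" using X_ge_1 by (simp add: ge_one_powr_ge_zero)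
  have "\<bar>real r * c\<bar> * real H ^ k = real r * (\<bar>c\<bar> * real H ^ k)" by (simp add: abs_mult)
  also have "\<dots> \<le> real H * (\<bar>c\<bar> * real H ^ k)"
    using \<open>r \<le> H\<close> by (intro mult_right_mono) auto
  also have "\<dots> \<le> 1 / 2" using small by (simp add: mult_ac)
  finally have "\<bar>real r * c\<bar> * real H ^ k \<le> 1 / 2" .
  moreover have "top_difference (Suc k) (real r * c) (\<lambda>h. P (h + r) - P h)"
    using differences unfolding top_difference.simps by blast
  ultimately have "norm (\<Sum>h<n. cis2pi (P (h + r) - P h)) \<le> C * real H * X' powr (- \<sigma>)"
    unfolding X'_def using \<open>n \<le> H\<close> sqrt_le sqrt_ge_1
    by (intro weyl_estimateD[OF weyl]) (auto simp: X'_def)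
  also have "\<dots> \<le> C * real H * (X powr (1/2)) powr (- \<sigma>)"
    using sqrt_le sqrt_ge_1 nonneg by (intro mult_left_mono powr_mono2') auto
  finally show ?thesis by (simp add: powr_powr)
qed

text \<open>The difference sums with a small step are estimated trivially, the others by the bound in
  degree \<open>k\<close>.\<close>
lemma weyl_estimate_Suc:
  assumes weyl: "weyl_estimate k C \<sigma>" and C_nonneg: "0 \<le> C" and \<sigma>_bounds: "0 \<le> \<sigma>" "\<sigma> \<le> 1"
  shows "weyl_estimate (Suc k) (3 + 2 * C) (\<sigma> / 4)"
  unfolding weyl_estimate_def
proof (intro allI impI)
  fix c P H n
  assume differences: "top_difference (Suc (Suc k)) c P" and "n \<le> H"
    and small: "\<bar>c\<bar> * real H ^ Suc k \<le> 1 / 2" and large: "1 \<le> \<bar>c\<bar> * real H ^ Suc (Suc k)"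
  define X where "X = \<bar>c\<bar> * real H ^ Suc (Suc k)"
  define y where "y = real H * X powr (- (1 / 2))"
  define B where "B = C * real H * X powr (- (\<sigma> / 2))"
  have X_ge_1: "X \<ge> 1" using large by (simp add: X_def)
  have "norm (\<Sum>h<n-r. cis2pi (P (h + r) - P h)) \<le> B" if "r \<in> {1..<n}" "y \<le> real r" for r
    unfolding B_def using that \<open>n \<le> H\<close> X_ge_1 weyl C_nonneg \<sigma>_bounds(1) differences small
    by (intro weyl_estimate_difference) (auto simp: X_def y_def)
  then have "(norm (\<Sum>h<n. cis2pi (P h)))\<^sup>2 \<le> real H + 2 * real H * (y + B)"
    using \<open>n \<le> H\<close> C_nonneg by (intro weyl_differencing) (auto simp: y_def B_def)
  moreover have "real H \<le> (real H)\<^sup>2 * X powr (- (\<sigma> / 2))"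
  proof -
    have "X = (\<bar>c\<bar> * real H ^ Suc k) * real H" by (simp add: X_def)
    also have "\<dots> \<le> 1 / 2 * real H" by (rule mult_right_mono[OF small]) simp
    finally have "real H \<le> (real H)\<^sup>2 * X powr (- 1)"
      using X_ge_1 by (simp add: powr_minus_divide power2_eq_square field_simps)
    also have "\<dots> \<le> (real H)\<^sup>2 * X powr (- (\<sigma> / 2))"
      using X_ge_1 \<sigma>_bounds by (intro mult_left_mono powr_mono) auto
    finally show ?thesis .
  qed
  moreover have "real H * (y + B) \<le> real H * ((1 + C) * real H * X powr (- (\<sigma> / 2)))"
  proof (intro mult_left_mono)
    have "y \<le> real H * X powr (- (\<sigma> / 2))"
      unfolding y_def using X_ge_1 \<sigma>_bounds by (intro mult_left_mono powr_mono) auto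
    then show "y + B \<le> (1 + C) * real H * X powr (- (\<sigma> / 2))"
      by (simp add: B_def algebra_simps)
  qed simp
  ultimately have "(norm (\<Sum>h<n. cis2pi (P h)))\<^sup>2 \<le> (3 + 2 * C) * ((real H)\<^sup>2 * X powr (- (\<sigma> / 2)))"
    by (simp add: algebra_simps power2_eq_square)
  also have "\<dots> \<le> (3 + 2 * C)\<^sup>2 * ((real H)\<^sup>2 * X powr (- (\<sigma> / 2)))"
    using C_nonneg by (intro mult_right_mono self_le_power) auto
  also have "\<dots> = ((3 + 2 * C) * real H * X powr (- (\<sigma> / 4)))\<^sup>2"
    by (simp add: power_mult_distrib power2_eq_square flip: powr_add)
  finally show "norm (\<Sum>h<n. cis2pi (P h)) \<le>
      (3 + 2 * C) * real H * (\<bar>c\<bar> * real H ^ Suc (Suc k)) powr (- (\<sigma> / 4))"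
    unfolding X_def[symmetric] by (rule power2_le_imp_le) (use C_nonneg in auto)
qed

lemma ex_weyl_estimate: "\<exists>C>0. \<exists>\<sigma>>0. \<sigma> \<le> 1 \<and> weyl_estimate k C \<sigma>"
proof (induction k)
  case 0
  show ?case using weyl_estimate_0 by (intro exI[of _ 1] conjI) auto
next
  case (Suc k)
  then obtain C \<sigma> where "C > 0" "\<sigma> > 0" "\<sigma> \<le> 1" "weyl_estimate k C \<sigma>" by blast
  then show ?case
    using weyl_estimate_Suc[of k C \<sigma>] by (intro exI[of _ "3 + 2 * C"] conjI exI[of _ "\<sigma> / 4"]) auto
qed

section \<open>Power saving from the size of the derivatives\<close>

lemma taylor_polynomial_error_le:
  fixes D :: "nat \<Rightarrow> real \<Rightarrow> real"
  assumes deriv: "\<And>m x. x > 0 \<Longrightarrow> (D m has_real_derivative D (Suc m) x) (at x)"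
    and pos: "a > 0" "y \<ge> 0" and bound: "\<And>x. x \<ge> a \<Longrightarrow> \<bar>D (Suc k) x\<bar> * y ^ Suc k \<le> E"
  shows "\<bar>D 0 (a + y) - (\<Sum>j\<le>k. D j a / fact j * y ^ j)\<bar> \<le> E"
proof (cases "y = 0")
  case True
  have "(\<Sum>j\<le>k. D j a / fact j * y ^ j) = (\<Sum>j\<le>k. if j = 0 then D 0 a else 0)"
    using True by (intro sum.cong) auto
  moreover have "0 \<le> E"
    using bound[of a] True by simp
  ultimately show ?thesis using True by simp
next
  case False
  have "\<exists>x. a < x \<and> x < a + y \<and> D 0 (a + y) =
      (\<Sum>m<Suc k. (D m a / fact m) * (a + y - a) ^ m) +
      (D (Suc k) x / fact (Suc k)) * (a + y - a) ^ Suc k"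
    by (rule Taylor_up[of _ D _ a]) (use deriv pos False in auto)
  then obtain x where "a < x"
    and taylor: "D 0 (a + y) - (\<Sum>j\<le>k. D j a / fact j * y ^ j) =
      D (Suc k) x * y ^ Suc k / fact (Suc k)"
    by (auto simp: lessThan_Suc_atMost simp del: fact_Suc power_Suc)
  have "\<bar>D (Suc k) x * y ^ Suc k / fact (Suc k)\<bar> = \<bar>D (Suc k) x\<bar> * y ^ Suc k / fact (Suc k)"
    using pos by (simp add: abs_mult del: fact_Suc power_Suc)
  also have "\<dots> \<le> \<bar>D (Suc k) x\<bar> * y ^ Suc k / 1"
    using pos by (intro divide_left_mono) (auto simp del: fact_Suc intro!: fact_ge_1)
  also have "\<dots> \<le> E" using bound[of x] \<open>a < x\<close> by simp
  finally show ?thesis unfolding taylor .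
qed

lemma norm_sum_cis2pi_block_le:
  fixes D :: "nat \<Rightarrow> real \<Rightarrow> real"
  assumes deriv: "\<And>m x. x > 0 \<Longrightarrow> (D m has_real_derivative D (Suc m) x) (at x)"
    and weyl: "weyl_estimate k C \<sigma>" "0 \<le> C" "0 \<le> \<sigma>" and "M > 0"
    and large: "1 \<le> X" "X \<le> \<bar>D (Suc k) (real M)\<bar> * real H ^ Suc k"
    and small: "\<bar>D (Suc k) (real M)\<bar> * real H ^ k \<le> 1 / 2"
    and error: "\<And>x. x \<ge> real M \<Longrightarrow> \<bar>D (Suc (Suc k)) x\<bar> * real H ^ Suc (Suc k) \<le> E"
  shows "norm (\<Sum>h<H. cis2pi (D 0 (real (M + h)))) \<le> real H * (C * X powr (- \<sigma>) + 2 * pi * E)"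
proof -
  define P where "P h = (\<Sum>j\<le>Suc k. D j (real M) / fact j * real h ^ j)" for h
  have "top_difference (Suc k) (fact (Suc k) * (D (Suc k) (real M) / fact (Suc k))) P"
    unfolding P_def by (rule top_difference_poly)
  then have "top_difference (Suc k) (D (Suc k) (real M)) P"
    by (simp del: top_difference.simps fact_Suc)
  then have "norm (\<Sum>h<H. cis2pi (P h)) \<le>
      C * real H * (\<bar>D (Suc k) (real M)\<bar> * real H ^ Suc k) powr (- \<sigma>)"
    using large small by (intro weyl_estimateD[OF weyl(1)]) auto
  also have "\<dots> \<le> C * real H * X powr (- \<sigma>)"
    using large weyl by (intro mult_left_mono powr_mono2') auto
  finally have "norm (\<Sum>h<H. cis2pi (P h)) \<le> C * real H * X powr (- \<sigma>)" .
  moreover have "\<bar>D 0 (real (M + h)) - P h\<bar> \<le> E" if "h < H" for h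
  proof -
    have "\<bar>D (Suc (Suc k)) x\<bar> * real h ^ Suc (Suc k) \<le> E" if "x \<ge> real M" for x
    proof -
      have "\<bar>D (Suc (Suc k)) x\<bar> * real h ^ Suc (Suc k) \<le> \<bar>D (Suc (Suc k)) x\<bar> * real H ^ Suc (Suc k)"
        using \<open>h < H\<close> by (intro mult_left_mono power_mono) auto
      also have "\<dots> \<le> E" by (rule error[OF that])
      finally show ?thesis .
    qed
    then show ?thesis
      unfolding P_def of_nat_add using \<open>M > 0\<close>
      by (intro taylor_polynomial_error_le[where D = D] deriv) auto
  qed
  then have "norm (\<Sum>h<H. cis2pi (D 0 (real (M + h)))) \<le>
      norm (\<Sum>h<H. cis2pi (P h)) + real (card {..<H}) * (2 * pi * E)"
    by (intro norm_sum_cis2pi_perturb) auto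
  ultimately show ?thesis by (simp add: algebra_simps)
qed

lemma abs_mult_power_le_powr:
  fixes x :: real
  assumes "1 \<le> x" "x \<le> z" "u \<le> 0" "0 \<le> c"
    and "\<bar>\<beta>\<bar> \<le> x powr s" "\<bar>v\<bar> \<le> c * z powr u" "0 \<le> h" "h \<le> 2 * x powr r"
  shows "\<bar>\<beta> * v\<bar> * h ^ i \<le> c * 2 ^ i * x powr (s + u + r * real i)"
proof -
  have "\<bar>v\<bar> \<le> c * x powr u"
    using assms by (intro order_trans[OF assms(6)] mult_left_mono powr_mono2') auto
  then have "\<bar>\<beta>\<bar> * \<bar>v\<bar> * h ^ i \<le> x powr s * (c * x powr u) * (2 * x powr r) ^ i"
    using assms by (intro mult_mono power_mono) auto
  also have "\<dots> = c * 2 ^ i * x powr (s + u + r * real i)"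
    using assms(1) by (simp add: power_mult_distrib powr_add powr_powr flip: powr_realpow)
  finally show ?thesis by (simp add: abs_mult)
qed

lemma abs_mult_power_ge_powr:
  fixes x :: real
  assumes "1 \<le> x" "0 < z" "z \<le> 2 * x" "u \<le> 0" "0 \<le> c"
    and "x powr s \<le> \<bar>\<beta>\<bar>" "c * z powr u \<le> \<bar>v\<bar>" "x powr r \<le> h"
  shows "c * 2 powr u * x powr (s + u + r * real i) \<le> \<bar>\<beta> * v\<bar> * h ^ i"
proof -
  have "c * (2 * x) powr u \<le> \<bar>v\<bar>"
    using assms by (intro order_trans[OF _ assms(7)] mult_left_mono powr_mono2') auto
  then have "x powr s * (c * (2 * x) powr u) * (x powr r) ^ i \<le> \<bar>\<beta>\<bar> * \<bar>v\<bar> * h ^ i"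
    using assms by (intro mult_mono power_mono) auto
  moreover have "x powr s * (c * (2 * x) powr u) * (x powr r) ^ i =
      c * 2 powr u * x powr (s + u + r * real i)"
    using assms(1) by (simp add: powr_mult powr_add powr_powr flip: powr_realpow)
  ultimately show ?thesis by (simp add: abs_mult)
qed

text \<open>The block length \<open>x powr (1 - 4 * s)\<close> makes the top Taylor term of the phase a small positive
  power of \<open>x\<close> and the next one a negative power, for all \<open>\<beta>\<close> in the given range at once.\<close>
lemma norm_sum_cis2pi_block_le_powr:
  fixes D :: "nat \<Rightarrow> real \<Rightarrow> real"
  assumes deriv: "\<And>m x. x > 0 \<Longrightarrow> (D m has_real_derivative D (Suc m) x) (at x)"
    and s_pos: "0 < s" and t_eq: "t = (4 * real (Suc k) + 2) * s"
    and t_le: "t \<le> real (Suc k)" and const_pos: "0 < c1" "0 < c2" "0 < c3"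
    and lower: "\<And>z. x \<le> z \<Longrightarrow> c1 * z powr (t - real (Suc k)) \<le> \<bar>D (Suc k) z\<bar>"
    and upper: "\<And>z. x \<le> z \<Longrightarrow> \<bar>D (Suc k) z\<bar> \<le> c2 * z powr (t - real (Suc k))"
    and upper': "\<And>z. x \<le> z \<Longrightarrow> \<bar>D (Suc (Suc k)) z\<bar> \<le> c3 * z powr (t - real (Suc (Suc k)))"
    and x_ge_1: "1 \<le> x" and main_large: "1 \<le> c1 * 2 powr (t - real (Suc k)) * x powr s"
    and slope_small: "c2 * 2 ^ k * x powr (7 * s - 1) \<le> 1 / 2"
    and weyl: "weyl_estimate k C \<sigma>" "0 < C" "0 < \<sigma>" "\<sigma> \<le> 1"
    and \<beta>_bounds: "x powr (- s) \<le> \<bar>\<beta>\<bar>" "\<bar>\<beta>\<bar> \<le> x powr s" and M_bounds: "x \<le> real M" "real M \<le> 2 * x"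
    and H_bounds: "x powr (1 - 4 * s) \<le> real H" "real H \<le> 2 * x powr (1 - 4 * s)"
  shows "norm (\<Sum>h<H. cis2pi (\<beta> * D 0 (real (M + h)))) \<le>
    real H * ((C * (c1 * 2 powr (t - real (Suc k))) powr (- \<sigma>) +
      2 * pi * (c3 * 2 ^ Suc (Suc k))) * x powr (- (s * \<sigma>)))"
proof -
  define c where "c = c1 * 2 powr (t - real (Suc k))"
  have c_pos: "c > 0" using const_pos by (simp add: c_def)
  have main_ge_1: "1 \<le> c * x powr s" using main_large by (simp only: c_def)
  have "c * x powr s = c1 * 2 powr (t - real (Suc k)) *
      x powr (- s + (t - real (Suc k)) + (1 - 4 * s) * real (Suc k))"
    unfolding c_def t_eq by (simp add: algebra_simps)
  also have "\<dots> \<le> \<bar>\<beta> * D (Suc k) (real M)\<bar> * real H ^ Suc k"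
    using x_ge_1 M_bounds const_pos t_le \<beta>_bounds H_bounds lower[of "real M"]
    by (intro abs_mult_power_ge_powr) auto
  finally have large: "c * x powr s \<le> \<bar>\<beta> * D (Suc k) (real M)\<bar> * real H ^ Suc k" .
  have "\<bar>\<beta> * D (Suc k) (real M)\<bar> * real H ^ k \<le>
      c2 * 2 ^ k * x powr (s + (t - real (Suc k)) + (1 - 4 * s) * real k)"
    using x_ge_1 M_bounds const_pos t_le \<beta>_bounds H_bounds upper[of "real M"]
    by (intro abs_mult_power_le_powr[where z = "real M"]) auto
  also have "\<dots> = c2 * 2 ^ k * x powr (7 * s - 1)"
    unfolding t_eq by (simp add: algebra_simps)
  finally have small: "\<bar>\<beta> * D (Suc k) (real M)\<bar> * real H ^ k \<le> 1 / 2"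
    using slope_small by linarith
  have error: "\<bar>\<beta> * D (Suc (Suc k)) z\<bar> * real H ^ Suc (Suc k) \<le> c3 * 2 ^ Suc (Suc k) * x powr (- s)"
    if "real M \<le> z" for z
  proof -
    have "\<bar>\<beta> * D (Suc (Suc k)) z\<bar> * real H ^ Suc (Suc k) \<le> c3 * 2 ^ Suc (Suc k) *
        x powr (s + (t - real (Suc (Suc k))) + (1 - 4 * s) * real (Suc (Suc k)))"
      using x_ge_1 M_bounds \<open>real M \<le> z\<close> const_pos t_le \<beta>_bounds H_bounds upper'[of z]
      by (intro abs_mult_power_le_powr[where z = z]) auto
    also have "s + (t - real (Suc (Suc k))) + (1 - 4 * s) * real (Suc (Suc k)) = - s"
      unfolding t_eq by (simp add: algebra_simps)
    finally show ?thesis .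
  qed
  have "norm (\<Sum>h<H. cis2pi (\<beta> * D 0 (real (M + h)))) \<le>
      real H * (C * (c * x powr s) powr (- \<sigma>) + 2 * pi * (c3 * 2 ^ Suc (Suc k) * x powr (- s)))"
    using weyl main_ge_1 x_ge_1 M_bounds large small error
    by (intro norm_sum_cis2pi_block_le[of "\<lambda>m x. \<beta> * D m x"] DERIV_cmult deriv) auto
  also have "\<dots> \<le> real H * (C * (c powr (- \<sigma>) * x powr (- (s * \<sigma>))) +
      2 * pi * (c3 * 2 ^ Suc (Suc k) * x powr (- (s * \<sigma>))))"
    using x_ge_1 s_pos weyl const_pos c_pos
    by (intro mult_left_mono add_mono powr_mono) (auto simp: powr_mult powr_powr)
  also have "\<dots> = real H *
      ((C * c powr (- \<sigma>) + 2 * pi * (c3 * 2 ^ Suc (Suc k))) * x powr (- (s * \<sigma>)))"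
    by (simp add: algebra_simps)
  finally show ?thesis unfolding c_def .
qed

definition block_power_saving :: "(nat \<Rightarrow> real) \<Rightarrow> real \<Rightarrow> real \<Rightarrow> bool" where
  "block_power_saving f s \<tau> \<longleftrightarrow> (\<exists>B>0. \<forall>\<^sub>F N in sequentially. \<forall>\<beta> M H.
     real N powr (- s) \<le> \<bar>\<beta>\<bar> \<longrightarrow> \<bar>\<beta>\<bar> \<le> real N powr s \<longrightarrow> N \<le> M \<longrightarrow> M \<le> 2 * N \<longrightarrow>
     real N powr (1 - 4 * s) \<le> real H \<longrightarrow> real H \<le> 2 * real N powr (1 - 4 * s) \<longrightarrow>
     norm (\<Sum>h<H. cis2pi (\<beta> * f (M + h))) \<le> real H * (B * real N powr (- \<tau>)))"

lemma block_power_saving_if_bigtheta_derivatives: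
  fixes D :: "nat \<Rightarrow> real \<Rightarrow> real"
  assumes deriv: "\<And>m x. x > 0 \<Longrightarrow> (D m has_real_derivative D (Suc m) x) (at x)"
    and s_bounds: "0 < s" "s < 1 / 8"
    and t_bounds: "t = (4 * real (Suc k) + 2) * s" "t \<le> real (Suc k)"
    and theta: "D (Suc k) \<in> \<Theta>(\<lambda>x. x powr (t - real (Suc k)))"
    and bigo: "D (Suc (Suc k)) \<in> O(\<lambda>x. x powr (t - real (Suc (Suc k))))"
    and weyl: "weyl_estimate k C \<sigma>" "0 < C" "0 < \<sigma>" "\<sigma> \<le> 1"
  shows "block_power_saving (\<lambda>n. D 0 (real n)) s (s * \<sigma>)"
proof -
  obtain c1 where "c1 > 0"
    and lower: "\<forall>\<^sub>F x in at_top. c1 * norm (x powr (t - real (Suc k))) \<le> norm (D (Suc k) x)"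
    by (rule landau_omega.bigE[OF bigthetaD2[OF theta]])
  obtain c2 where "c2 > 0"
    and upper: "\<forall>\<^sub>F x in at_top. norm (D (Suc k) x) \<le> c2 * norm (x powr (t - real (Suc k)))"
    by (rule landau_o.bigE[OF bigthetaD1[OF theta]])
  obtain c3 where "c3 > 0" and
    upper': "\<forall>\<^sub>F x in at_top. norm (D (Suc (Suc k)) x) \<le>
      c3 * norm (x powr (t - real (Suc (Suc k))))"
    by (rule landau_o.bigE[OF bigo])
  note const_pos = \<open>c1 > 0\<close> \<open>c2 > 0\<close> \<open>c3 > 0\<close>
  from lower upper upper' have "\<forall>\<^sub>F x in at_top. c1 * x powr (t - real (Suc k)) \<le> \<bar>D (Suc k) x\<bar> \<and>
      \<bar>D (Suc k) x\<bar> \<le> c2 * x powr (t - real (Suc k)) \<and>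
      \<bar>D (Suc (Suc k)) x\<bar> \<le> c3 * x powr (t - real (Suc (Suc k)))"
    by eventually_elim auto
  note bounds = eventually_compose_filterlim[OF eventually_all_ge_at_top[OF this]
      filterlim_real_sequentially]
  define c where "c = c1 * 2 powr (t - real (Suc k))"
  define B where "B = C * c powr (- \<sigma>) + 2 * pi * (c3 * 2 ^ Suc (Suc k))"
  have c_pos: "c > 0" using const_pos by (simp add: c_def)
  have "\<forall>\<^sub>F N in sequentially. 1 \<le> c * real N powr s"
    using s_bounds c_pos by real_asymp
  moreover have "\<forall>\<^sub>F N in sequentially. c2 * 2 ^ k * real N powr (7 * s - 1) \<le> 1 / 2"
    using s_bounds const_pos by real_asymp
  ultimately have "\<forall>\<^sub>F N in sequentially. \<forall>\<beta> M H.
     real N powr (- s) \<le> \<bar>\<beta>\<bar> \<longrightarrow> \<bar>\<beta>\<bar> \<le> real N powr s \<longrightarrow> N \<le> M \<longrightarrow> M \<le> 2 * N \<longrightarrow>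
     real N powr (1 - 4 * s) \<le> real H \<longrightarrow> real H \<le> 2 * real N powr (1 - 4 * s) \<longrightarrow>
     norm (\<Sum>h<H. cis2pi (\<beta> * D 0 (real (M + h)))) \<le> real H * (B * real N powr (- (s * \<sigma>)))"
    using bounds eventually_ge_at_top[of 1]
  proof eventually_elim
    case (elim N)
    then show ?case
      unfolding B_def c_def using s_bounds t_bounds const_pos weyl
      by (intro allI impI norm_sum_cis2pi_block_le_powr[where D = D and ?c2.0 = c2] deriv) auto
  qed
  moreover have "B > 0" using c_pos weyl const_pos by (simp add: B_def add_pos_pos)
  ultimately show ?thesis unfolding block_power_saving_def by blast
qed

lemma norm_sum_shift_diff_le:
  fixes u :: "nat \<Rightarrow> 'a :: real_normed_vector"
  assumes "a \<le> b" "\<And>n. norm (u n) \<le> 1"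
  shows "norm ((\<Sum>n=a..<b. u n) - (\<Sum>n=a..<b. u (n + h))) \<le> 2 * real h"
proof (induction h)
  case (Suc h)
  have "(\<Sum>n=a..<b. u (Suc n + h) - u (n + h)) = u (b + h) - u (a + h)"
    using assms(1) by (rule sum_Suc_diff')
  then have telescope: "(\<Sum>n=a..<b. u (n + h)) - (\<Sum>n=a..<b. u (n + Suc h)) = u (a + h) - u (b + h)"
    by (simp add: sum_subtractf algebra_simps)
  have "norm ((\<Sum>n=a..<b. u n) - (\<Sum>n=a..<b. u (n + Suc h))) =
      norm (((\<Sum>n=a..<b. u n) - (\<Sum>n=a..<b. u (n + h))) + (u (a + h) - u (b + h)))"
    unfolding telescope[symmetric] by simp
  also have "\<dots> \<le> 2 * real h + (1 + 1)"
    by (intro order_trans[OF norm_triangle_ineq] add_mono Suc.IH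
        order_trans[OF norm_triangle_ineq4] assms)
  finally show ?case by simp
qed auto

lemma norm_sum_le_block_average:
  fixes u :: "nat \<Rightarrow> 'a :: real_normed_field"
  assumes "a \<le> b" "\<And>n. norm (u n) \<le> 1" "H > 0"
    and block: "\<And>M. M \<in> {a..<b} \<Longrightarrow> norm (\<Sum>h<H. u (M + h)) \<le> real H * B"
  shows "norm (\<Sum>n=a..<b. u n) \<le> real (b - a) * B + 2 * real H"
proof -
  let ?S = "\<Sum>n=a..<b. u n"
  have "of_nat H * ?S = (\<Sum>h<H. ?S - (\<Sum>n=a..<b. u (n + h))) + (\<Sum>h<H. \<Sum>n=a..<b. u (n + h))"
    by (simp add: sum_subtractf)
  also have "(\<Sum>h<H. \<Sum>n=a..<b. u (n + h)) = (\<Sum>n=a..<b. \<Sum>h<H. u (n + h))"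
    by (rule sum.swap)
  finally have "norm (of_nat H * ?S) \<le>
      norm (\<Sum>h<H. ?S - (\<Sum>n=a..<b. u (n + h))) + norm (\<Sum>n=a..<b. \<Sum>h<H. u (n + h))"
    by (simp add: norm_triangle_ineq)
  also have "norm (\<Sum>h<H. ?S - (\<Sum>n=a..<b. u (n + h))) \<le> (\<Sum>h<H. 2 * real H)"
  proof (rule sum_norm_le)
    fix h assume "h \<in> {..<H}"
    then show "norm (?S - (\<Sum>n=a..<b. u (n + h))) \<le> 2 * real H"
      using norm_sum_shift_diff_le[of a b u h, OF assms(1,2)] by simp
  qed
  also have "norm (\<Sum>n=a..<b. \<Sum>h<H. u (n + h)) \<le> (\<Sum>n=a..<b. real H * B)"
    by (rule sum_norm_le) (use block in auto)
  finally have "real H * norm ?S \<le> real H * (real (b - a) * B + 2 * real H)"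
    by (simp add: norm_mult algebra_simps)
  then show ?thesis using \<open>H > 0\<close> by simp
qed

definition power_saving :: "(nat \<Rightarrow> real) \<Rightarrow> real \<Rightarrow> bool" where
  "power_saving f \<sigma> \<longleftrightarrow> (\<forall>\<^sub>F N in sequentially. \<forall>\<beta>.
     real N powr (- \<sigma>) \<le> \<bar>\<beta>\<bar> \<longrightarrow> \<bar>\<beta>\<bar> \<le> real N powr \<sigma> \<longrightarrow>
     norm (\<Sum>n=N..<2*N. cis2pi (\<beta> * f n)) \<le> real N powr (1 - \<sigma>))"

lemma power_saving_if_block_power_saving:
  assumes block: "block_power_saving f s \<tau>" and \<tau>_bounds: "0 < \<tau>" "\<tau> \<le> s" and s_le: "4 * s \<le> 1"
  shows "power_saving f (\<tau> / 2)"
proof -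
  obtain B where bound: "\<forall>\<^sub>F N in sequentially. \<forall>\<beta> M H.
     real N powr (- s) \<le> \<bar>\<beta>\<bar> \<longrightarrow> \<bar>\<beta>\<bar> \<le> real N powr s \<longrightarrow> N \<le> M \<longrightarrow> M \<le> 2 * N \<longrightarrow>
     real N powr (1 - 4 * s) \<le> real H \<longrightarrow> real H \<le> 2 * real N powr (1 - 4 * s) \<longrightarrow>
     norm (\<Sum>h<H. cis2pi (\<beta> * f (M + h))) \<le> real H * (B * real N powr (- \<tau>))"
    using block unfolding block_power_saving_def by blast
  have "\<forall>\<^sub>F N in sequentially. B + 4 \<le> real N powr (\<tau> / 2)"
    using \<tau>_bounds by real_asymp
  then show ?thesis
    unfolding power_saving_def using bound eventually_ge_at_top[of 1]
  proof eventually_elim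
    case (elim N)
    define H where "H = nat \<lceil>real N powr (1 - 4 * s)\<rceil>"
    have "1 \<le> real N powr (1 - 4 * s)"
      using elim s_le by (intro ge_one_powr_ge_zero) auto
    then have H_bounds: "0 < H" "real N powr (1 - 4 * s) \<le> real H"
      "real H \<le> 2 * real N powr (1 - 4 * s)"
      unfolding H_def by linarith+
    show ?case
    proof (intro allI impI)
      fix \<beta> assume "real N powr (- (\<tau> / 2)) \<le> \<bar>\<beta>\<bar>" "\<bar>\<beta>\<bar> \<le> real N powr (\<tau> / 2)"
      moreover have "real N powr (- s) \<le> real N powr (- (\<tau> / 2))"
        "real N powr (\<tau> / 2) \<le> real N powr s"
        using elim \<tau>_bounds by (auto intro!: powr_mono)
      ultimately have "real N powr (- s) \<le> \<bar>\<beta>\<bar>" "\<bar>\<beta>\<bar> \<le> real N powr s"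
        by linarith+
      then have "norm (\<Sum>n=N..<2*N. cis2pi (\<beta> * f n)) \<le>
          real (2 * N - N) * (B * real N powr (- \<tau>)) + 2 * real H"
        using elim H_bounds by (intro norm_sum_le_block_average) auto
      also have "\<dots> \<le> real N * (B * real N powr (- \<tau>)) + 4 * real N powr (1 - \<tau>)"
      proof -
        have "real N powr (1 - 4 * s) \<le> real N powr (1 - \<tau>)"
          using elim(3) \<tau>_bounds by (intro powr_mono) auto
        then show ?thesis using H_bounds by simp
      qed
      also have "\<dots> = (B + 4) * real N powr (1 - \<tau>)"
        using elim by (simp add: powr_diff powr_minus field_simps)
      also have "\<dots> \<le> real N powr (\<tau> / 2) * real N powr (1 - \<tau>)"
        using elim by (intro mult_right_mono) auto
      also have "\<dots> = real N powr (1 - \<tau> / 2)"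
        by (simp flip: powr_add)
      finally show "norm (\<Sum>n=N..<2*N. cis2pi (\<beta> * f n)) \<le> real N powr (1 - \<tau> / 2)" .
    qed
  qed
qed

lemma power_saving_if_bigtheta_derivatives:
  fixes D :: "nat \<Rightarrow> real \<Rightarrow> real"
  assumes deriv: "\<And>m x. x > 0 \<Longrightarrow> (D m has_real_derivative D (Suc m) x) (at x)"
    and t_bounds: "0 < t" "2 * t < real (Suc k)"
    and theta: "D (Suc k) \<in> \<Theta>(\<lambda>x. x powr (t - real (Suc k)))"
    and bigo: "D (Suc (Suc k)) \<in> O(\<lambda>x. x powr (t - real (Suc (Suc k))))"
  shows "\<exists>\<sigma>>0. \<sigma> < 1 \<and> power_saving (\<lambda>n. D 0 (real n)) \<sigma>"
proof -
  obtain C \<sigma> where weyl: "C > 0" "\<sigma> > 0" "\<sigma> \<le> 1" "weyl_estimate k C \<sigma>"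
    using ex_weyl_estimate by blast
  define s where "s = t / (4 * real (Suc k) + 2)"
  have s_bounds: "0 < s" "s < 1 / 8" "t = (4 * real (Suc k) + 2) * s"
    using t_bounds by (simp_all add: s_def field_simps)
  have exponent: "0 < s * \<sigma>" "s * \<sigma> \<le> s" using s_bounds weyl by simp_all
  have "block_power_saving (\<lambda>n. D 0 (real n)) s (s * \<sigma>)"
    using deriv s_bounds t_bounds theta bigo weyl
    by (intro block_power_saving_if_bigtheta_derivatives[where D = D and t = t and C = C]) auto
  then have "power_saving (\<lambda>n. D 0 (real n)) (s * \<sigma> / 2)"
    using exponent s_bounds(2) by (intro power_saving_if_block_power_saving) auto
  with exponent s_bounds(2) show ?thesis by (intro exI[of _ "s * \<sigma> / 2"]) auto
qed

section \<open>A quantitative Weyl criterion\<close>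

lemma sum_norm_sq_deviation_le:
  fixes z :: "'b \<Rightarrow> 'a \<Rightarrow> complex"
  assumes "finite B" "0 \<le> \<epsilon>" and norm: "\<And>h n. h \<in> B \<Longrightarrow> n \<in> S \<Longrightarrow> norm (z h n) = 1"
    and corr: "\<And>h h'. h \<in> B \<Longrightarrow> h' \<in> B \<Longrightarrow> h \<noteq> h' \<Longrightarrow> norm (\<Sum>n\<in>S. z h n * cnj (z h' n)) \<le> \<epsilon>"
  shows "\<bar>(\<Sum>n\<in>S. (norm (\<Sum>h\<in>B. z h n))\<^sup>2) - real (card B) * real (card S)\<bar> \<le> (real (card B))\<^sup>2 * \<epsilon>"
proof -
  define Q where "Q h h' = (\<Sum>n\<in>S. z h n * cnj (z h' n))" for h h'
  define \<Delta> where "\<Delta> h h' = (if h = h' then complex_of_real (real (card S)) else 0)" for h h' :: 'b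
  have "complex_of_real (\<Sum>n\<in>S. (norm (\<Sum>h\<in>B. z h n))\<^sup>2) = (\<Sum>n\<in>S. \<Sum>h\<in>B. \<Sum>h'\<in>B. z h n * cnj (z h' n))"
    unfolding of_real_sum complex_norm_square cnj_sum sum_product ..
  also have "\<dots> = (\<Sum>h\<in>B. \<Sum>n\<in>S. \<Sum>h'\<in>B. z h n * cnj (z h' n))"
    by (rule sum.swap)
  also have "\<dots> = (\<Sum>h\<in>B. \<Sum>h'\<in>B. Q h h')"
    unfolding Q_def by (intro sum.cong refl sum.swap)
  finally have moment: "complex_of_real (\<Sum>n\<in>S. (norm (\<Sum>h\<in>B. z h n))\<^sup>2) = (\<Sum>h\<in>B. \<Sum>h'\<in>B. Q h h')" .
  have diagonal: "complex_of_real (real (card B) * real (card S)) = (\<Sum>h\<in>B. \<Sum>h'\<in>B. \<Delta> h h')"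
    using assms(1) by (simp add: \<Delta>_def)
  have entry: "norm (Q h h' - \<Delta> h h') \<le> \<epsilon>" if "h \<in> B" "h' \<in> B" for h h'
  proof (cases "h = h'")
    case True
    have "Q h h' = (\<Sum>n\<in>S. 1)"
      unfolding Q_def True using norm[OF that(2)]
      by (intro sum.cong) (auto simp flip: complex_norm_square)
    then show ?thesis using True assms(2) by (simp add: \<Delta>_def)
  next
    case False
    then show ?thesis using corr[OF that] by (simp add: Q_def \<Delta>_def)
  qed
  have "\<bar>(\<Sum>n\<in>S. (norm (\<Sum>h\<in>B. z h n))\<^sup>2) - real (card B) * real (card S)\<bar> =
      norm (complex_of_real ((\<Sum>n\<in>S. (norm (\<Sum>h\<in>B. z h n))\<^sup>2) - real (card B) * real (card S)))"
    by (rule norm_of_real[symmetric])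
  also have "\<dots> = norm (\<Sum>h\<in>B. \<Sum>h'\<in>B. Q h h' - \<Delta> h h')"
    unfolding of_real_diff moment diagonal by (simp add: sum_subtractf)
  also have "\<dots> \<le> (\<Sum>h\<in>B. \<Sum>h'\<in>B. \<epsilon>)"
    by (intro sum_norm_le entry)
  finally show ?thesis by (simp add: power2_eq_square)
qed

definition fejer_kernel :: "nat \<Rightarrow> real \<Rightarrow> real" where
  "fejer_kernel H x = (norm (\<Sum>h<H. cis2pi (real h * x)))\<^sup>2 / real H"

lemma fejer_kernel_nonneg: "0 \<le> fejer_kernel H x"
  by (simp add: fejer_kernel_def)

lemma fejer_kernel_le:
  assumes "0 < \<delta>" "\<delta> \<le> dist_nint x"
  shows "fejer_kernel H x \<le> 1 / (4 * real H * \<delta>\<^sup>2)"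
proof -
  have "\<delta> * norm (\<Sum>h<H. cis2pi (real h * x)) \<le> dist_nint x * norm (\<Sum>h<H. cis2pi (real h * x))"
    using assms(2) by (rule mult_right_mono) simp
  also have "\<dots> \<le> 1 / 2"
    using dist_nint_mult_norm_sum_cis2pi_le[of x 0 H] by simp
  finally have "(\<delta> * norm (\<Sum>h<H. cis2pi (real h * x)))\<^sup>2 \<le> (1 / 2)\<^sup>2"
    using assms(1) by (intro power_mono) auto
  then have "(norm (\<Sum>h<H. cis2pi (real h * x)))\<^sup>2 \<le> 1 / (4 * \<delta>\<^sup>2)"
    using assms(1) by (simp add: power_mult_distrib power2_eq_square field_simps)
  then have "fejer_kernel H x \<le> 1 / (4 * \<delta>\<^sup>2) / real H"
    unfolding fejer_kernel_def by (rule divide_right_mono) simp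
  then show ?thesis by (simp add: mult_ac)
qed

lemma prod_fejer_kernel:
  assumes "finite I"
  shows "(\<Prod>i\<in>I. fejer_kernel H (x i)) =
    (norm (\<Sum>g\<in>I \<rightarrow>\<^sub>E {..<H}. cis2pi (\<Sum>i\<in>I. real (g i) * x i)))\<^sup>2 / real H ^ card I"
proof -
  have "(\<Prod>i\<in>I. \<Sum>h<H. cis2pi (real h * x i)) =
      (\<Sum>g\<in>I \<rightarrow>\<^sub>E {..<H}. cis2pi (\<Sum>i\<in>I. real (g i) * x i))"
    using assms by (simp add: prod_sum_PiE cis2pi_sum)
  then show ?thesis
    by (simp add: fejer_kernel_def prod_dividef prod_norm flip: prod_power_distrib)
qed

definition exp_sums_small :: "'a set \<Rightarrow> 'i set \<Rightarrow> nat \<Rightarrow> ('a \<Rightarrow> 'i \<Rightarrow> real) \<Rightarrow> bool" where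
  "exp_sums_small S I H x \<longleftrightarrow> (\<forall>c :: 'i \<Rightarrow> int. (\<exists>i\<in>I. c i \<noteq> 0) \<longrightarrow> (\<forall>i\<in>I. \<bar>c i\<bar> < int H) \<longrightarrow>
     norm (\<Sum>n\<in>S. cis2pi (\<Sum>i\<in>I. of_int (c i) * x n i)) \<le> real (card S) / (2 * real H ^ card I))"

lemma exp_sums_small_subset:
  assumes small: "exp_sums_small S I H x" and "finite I" "J \<subseteq> I" "H > 0"
  shows "exp_sums_small S J H x"
  unfolding exp_sums_small_def
proof (intro allI impI)
  fix c :: "'b \<Rightarrow> int" assume coeffs: "\<exists>i\<in>J. c i \<noteq> 0" "\<forall>i\<in>J. \<bar>c i\<bar> < int H"
  define c' where "c' i = (if i \<in> J then c i else 0)" for i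
  have "(\<Sum>i\<in>J. of_int (c i) * x n i) = (\<Sum>i\<in>I. of_int (c' i) * x n i)" for n
    using assms by (intro sum.mono_neutral_cong_left) (auto simp: c'_def)
  moreover have "\<exists>i\<in>I. c' i \<noteq> 0"
    using coeffs(1) assms(3) by (force simp: c'_def)
  moreover have "\<forall>i\<in>I. \<bar>c' i\<bar> < int H"
    using coeffs(2) assms(4) by (simp add: c'_def)
  ultimately have "norm (\<Sum>n\<in>S. cis2pi (\<Sum>i\<in>J. of_int (c i) * x n i)) \<le>
      real (card S) / (2 * real H ^ card I)"
    using small by (simp add: exp_sums_small_def)
  also have "\<dots> \<le> real (card S) / (2 * real H ^ card J)"
    using assms by (intro divide_left_mono mult_left_mono power_increasing card_mono) auto
  finally show "norm (\<Sum>n\<in>S. cis2pi (\<Sum>i\<in>J. of_int (c i) * x n i)) \<le>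
      real (card S) / (2 * real H ^ card J)" .
qed

lemma sum_prod_fejer_kernel_deviation_le:
  assumes "finite I" "H > 0" and small: "exp_sums_small S I H x"
  shows "\<bar>(\<Sum>n\<in>S. \<Prod>i\<in>I. fejer_kernel H (x n i - y i)) - real (card S)\<bar> \<le> real (card S) / 2"
proof -
  define B where "B = I \<rightarrow>\<^sub>E {..<H}"
  define z where "z g n = cis2pi (\<Sum>i\<in>I. real (g i) * (x n i - y i))" for g n
  define q where "q = real H ^ card I"
  have q_eq: "q > 0" "real (card B) = q"
    using assms by (simp_all add: q_def B_def card_PiE)
  have "norm (\<Sum>n\<in>S. z g n * cnj (z g' n)) \<le> real (card S) / (2 * q)"
    if distinct: "g \<in> B" "g' \<in> B" "g \<noteq> g'" for g g'
  proof -
    define c where "c i = int (g i) - int (g' i)" for i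
    have "z g n * cnj (z g' n) =
        cis2pi (\<Sum>i\<in>I. of_int (c i) * x n i) * cis2pi (- (\<Sum>i\<in>I. of_int (c i) * y i))" for n
      by (simp add: z_def c_def cnj_cis2pi algebra_simps sum_subtractf sum.distrib flip: cis2pi_add)
    then have "norm (\<Sum>n\<in>S. z g n * cnj (z g' n)) =
        norm (\<Sum>n\<in>S. cis2pi (\<Sum>i\<in>I. of_int (c i) * x n i))"
      by (simp add: norm_mult flip: sum_distrib_right)
    moreover have "\<exists>i\<in>I. c i \<noteq> 0"
      using distinct PiE_ext[of g I "\<lambda>_. {..<H}" g'] by (auto simp: B_def c_def)
    moreover have "\<forall>i\<in>I. \<bar>c i\<bar> < int H"
      using distinct by (fastforce simp: B_def c_def PiE_iff)
    ultimately show ?thesis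
      using small unfolding exp_sums_small_def q_def by simp
  qed
  then have "\<bar>(\<Sum>n\<in>S. (norm (\<Sum>g\<in>B. z g n))\<^sup>2) - real (card B) * real (card S)\<bar> \<le>
      (real (card B))\<^sup>2 * (real (card S) / (2 * q))"
    using assms q_eq by (intro sum_norm_sq_deviation_le) (auto simp: B_def z_def intro: finite_PiE)
  then have "\<bar>(\<Sum>n\<in>S. (norm (\<Sum>g\<in>B. z g n))\<^sup>2) - q * real (card S)\<bar> / q \<le> real (card S) / 2"
    using q_eq by (simp add: power2_eq_square field_simps)
  also have "\<bar>(\<Sum>n\<in>S. (norm (\<Sum>g\<in>B. z g n))\<^sup>2) - q * real (card S)\<bar> / q =
      \<bar>(\<Sum>n\<in>S. (norm (\<Sum>g\<in>B. z g n))\<^sup>2 / q) - real (card S)\<bar>"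
  proof -
    have "(\<Sum>n\<in>S. (norm (\<Sum>g\<in>B. z g n))\<^sup>2 / q) - real (card S) =
        ((\<Sum>n\<in>S. (norm (\<Sum>g\<in>B. z g n))\<^sup>2) - q * real (card S)) / q"
      using q_eq by (simp add: diff_divide_distrib sum_divide_distrib)
    then show ?thesis using q_eq by (simp add: abs_divide)
  qed
  finally show ?thesis
    using assms(1) by (simp add: prod_fejer_kernel B_def z_def q_def)
qed

text \<open>If every \<open>n\<close> failed in some coordinate, omitting the Fejer kernel of that coordinate would
  show that the product of all kernels has too small a mean.\<close>
lemma ex_all_dist_nint_less:
  assumes "finite S" "S \<noteq> {}" "finite I" "H > 0" and small: "exp_sums_small S I H x"
  shows "\<exists>n\<in>S. \<forall>i\<in>I. dist_nint (x n i - y i) < sqrt (real (card I) / real H)"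
proof (rule ccontr)
  define \<delta> where "\<delta> = sqrt (real (card I) / real H)"
  define F where "F n i = fejer_kernel H (x n i - y i)" for n i
  define d where "d = real (card I)"
  assume "\<not> ?thesis"
  then have far: "\<exists>i\<in>I. \<delta> \<le> dist_nint (x n i - y i)" if "n \<in> S" for n
    using that by (auto simp: \<delta>_def not_less)
  then have "I \<noteq> {}" using assms(2) by blast
  then have d_pos: "d > 0" and \<delta>_pos: "\<delta> > 0" "real H * \<delta>\<^sup>2 = d"
    using assms by (simp_all add: d_def \<delta>_def card_gt_0_iff)
  have F_nonneg: "0 \<le> F n i" for n i by (simp add: F_def fejer_kernel_nonneg)
  have pointwise: "(\<Prod>i\<in>I. F n i) \<le> (\<Sum>i\<in>I. 1 / (4 * d) * (\<Prod>j\<in>I-{i}. F n j))" if "n \<in> S" for n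
  proof -
    obtain i where i_far: "i \<in> I" "\<delta> \<le> dist_nint (x n i - y i)"
      using far \<open>n \<in> S\<close> by blast
    have "F n i \<le> 1 / (4 * d)"
      using fejer_kernel_le[OF \<delta>_pos(1) i_far(2), of H] \<delta>_pos(2) by (simp add: F_def mult.assoc)
    then have "F n i * (\<Prod>j\<in>I-{i}. F n j) \<le> 1 / (4 * d) * (\<Prod>j\<in>I-{i}. F n j)"
      by (intro mult_right_mono prod_nonneg) (auto simp: F_nonneg)
    also have "\<dots> \<le> (\<Sum>i\<in>I. 1 / (4 * d) * (\<Prod>j\<in>I-{i}. F n j))"
      using i_far assms d_pos
      by (intro member_le_sum mult_nonneg_nonneg prod_nonneg) (auto simp: F_nonneg)
    finally show ?thesis using i_far assms by (simp add: prod.remove)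
  qed
  have mean: "\<bar>(\<Sum>n\<in>S. \<Prod>j\<in>J. F n j) - real (card S)\<bar> \<le> real (card S) / 2" if "J \<subseteq> I" for J
    unfolding F_def using that assms
    by (intro sum_prod_fejer_kernel_deviation_le exp_sums_small_subset[OF small])
      (auto intro: finite_subset)
  have "real (card S) / 2 \<le> (\<Sum>n\<in>S. \<Prod>i\<in>I. F n i)"
    using mean[OF order_refl] by linarith
  also have "\<dots> \<le> (\<Sum>n\<in>S. \<Sum>i\<in>I. 1 / (4 * d) * (\<Prod>j\<in>I-{i}. F n j))"
    by (intro sum_mono pointwise)
  also have "\<dots> = (\<Sum>i\<in>I. 1 / (4 * d) * (\<Sum>n\<in>S. \<Prod>j\<in>I-{i}. F n j))"
    unfolding sum_distrib_left by (rule sum.swap)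
  also have "\<dots> \<le> (\<Sum>i\<in>I. 1 / (4 * d) * (3 / 2 * real (card S)))"
  proof (intro sum_mono mult_left_mono)
    show "(\<Sum>n\<in>S. \<Prod>j\<in>I-{i}. F n j) \<le> 3 / 2 * real (card S)" for i
      using mean[OF Diff_subset, of "{i}"] by linarith
  qed (use d_pos in simp)
  also have "\<dots> = 3 / 8 * real (card S)"
    using d_pos by (simp add: d_def)
  finally show False using assms by (simp add: card_gt_0_iff)
qed

section \<open>Pseudo-polynomials\<close>

definition pp_deriv :: "nat \<Rightarrow> (nat \<Rightarrow> real) \<Rightarrow> (nat \<Rightarrow> real) \<Rightarrow> nat \<Rightarrow> real \<Rightarrow> real" where
  "pp_deriv d \<alpha> \<theta> k x = (\<Sum>i=1..d. \<alpha> i * (\<Prod>j<k. \<theta> i - real j) * x powr (\<theta> i - real k))"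

lemma pp_deriv_0: "pp_deriv d \<alpha> \<theta> 0 = pp_eval d \<alpha> \<theta>"
  by (rule ext) (simp add: pp_deriv_def pp_eval_def)

lemma has_real_derivative_pp_deriv:
  assumes "x > 0"
  shows "(pp_deriv d \<alpha> \<theta> k has_real_derivative pp_deriv d \<alpha> \<theta> (Suc k) x) (at x)"
proof -
  have "((\<lambda>x. \<Sum>i=1..d. \<alpha> i * (\<Prod>j<k. \<theta> i - real j) * x powr (\<theta> i - real k))
      has_real_derivative (\<Sum>i=1..d. \<alpha> i * (\<Prod>j<k. \<theta> i - real j) *
        ((\<theta> i - real k) * x powr (\<theta> i - real k - 1)))) (at x)"
    by (intro DERIV_sum DERIV_cmult has_real_derivative_powr assms)
  then show ?thesis
    unfolding pp_deriv_def[abs_def] by (simp add: mult_ac diff_diff_eq add.commute)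
qed

text \<open>Differentiating more than \<open>\<theta> i\<close> times kills every integral exponent, so that the largest
  non-integral one takes over.\<close>
lemma pp_deriv_bigtheta:
  assumes m_nonint: "m \<in> {1..d}" "\<theta> m \<notin> \<int>" "\<alpha> m \<noteq> 0"
    and top: "\<And>i. i \<in> {1..d} \<Longrightarrow> i \<noteq> m \<Longrightarrow> \<theta> i \<notin> \<int> \<Longrightarrow> \<theta> i < \<theta> m"
    and range: "\<And>i. i \<in> {1..d} \<Longrightarrow> 0 \<le> \<theta> i \<and> \<theta> i < real k"
  shows "pp_deriv d \<alpha> \<theta> k \<in> \<Theta>(\<lambda>x. x powr (\<theta> m - real k))"
proof -
  define p where "p i = \<alpha> i * (\<Prod>j<k. \<theta> i - real j)" for i
  have "(\<lambda>x. p i * x powr (\<theta> i - real k)) \<in> o(\<lambda>x. x powr (\<theta> m - real k))"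
    if i: "i \<in> {1..d} - {m}" for i
  proof (cases "\<theta> i \<in> \<int>")
    case True
    then obtain z where "\<theta> i = of_int z" by (auto elim: Ints_cases)
    then have "\<theta> i = real (nat z)" "nat z < k" using range[of i] i by auto
    then have "p i = 0" unfolding p_def by (auto simp: prod_zero_iff)
    then show ?thesis by simp
  next
    case False
    then have "\<theta> i < \<theta> m" using top i by auto
    then have "(\<lambda>x. x powr (\<theta> i - real k)) \<in> o(\<lambda>x. x powr (\<theta> m - real k))" by real_asymp
    then show ?thesis by (cases "p i = 0") simp_all
  qed
  then have "(\<lambda>x. \<Sum>i\<in>{1..d}-{m}. p i * x powr (\<theta> i - real k)) \<in> o(\<lambda>x. x powr (\<theta> m - real k))"
    by (rule big_sum_in_smallo)
  moreover have "p m \<noteq> 0"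
    using m_nonint by (auto simp: p_def)
  ultimately have "(\<lambda>x. \<Sum>i\<in>{1..d}-{m}. p i * x powr (\<theta> i - real k)) \<in>
      o(\<lambda>x. p m * x powr (\<theta> m - real k))"
    by simp
  from landau_theta.plus_absorb1[OF this]
  have "(\<lambda>x. (\<Sum>i\<in>{1..d}-{m}. p i * x powr (\<theta> i - real k)) + p m * x powr (\<theta> m - real k)) \<in>
      \<Theta>(\<lambda>x. p m * x powr (\<theta> m - real k))"
    using bigtheta_refl by blast
  moreover have "pp_deriv d \<alpha> \<theta> k x =
      (\<Sum>i\<in>{1..d}-{m}. p i * x powr (\<theta> i - real k)) + p m * x powr (\<theta> m - real k)" for x
    unfolding pp_deriv_def p_def using m_nonint(1) by (subst sum.remove[of _ m]) auto
  ultimately have "pp_deriv d \<alpha> \<theta> k \<in> \<Theta>(\<lambda>x. p m * x powr (\<theta> m - real k))"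
    by presburger
  with \<open>p m \<noteq> 0\<close> show ?thesis by simp
qed

lemma pseudo_poly_exponent_less:
  assumes "pseudo_poly d \<alpha> \<theta>" "i \<in> {1..d}" "j \<in> {1..d}" "i < j"
  shows "\<theta> i < \<theta> j"
  using assms by (simp add: pseudo_poly_def)

lemma pseudo_poly_exponent_ge_1:
  assumes "pseudo_poly d \<alpha> \<theta>" "i \<in> {1..d}"
  shows "1 \<le> \<theta> i"
proof -
  have "\<theta> 1 \<le> \<theta> i"
    using pseudo_poly_exponent_less[OF assms(1), of 1 i] assms(2) by (cases "i = 1") auto
  then show ?thesis using assms(1) by (simp add: pseudo_poly_def)
qed

lemma pseudo_poly_exponent_le_top:
  assumes "pseudo_poly d \<alpha> \<theta>" "i \<in> {1..d}"
  shows "\<theta> i \<le> \<theta> d"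
  using pseudo_poly_exponent_less[OF assms(1), of i d] assms(2) by (cases "i = d") auto

lemma pp_eval_bounds:
  assumes pp: "pseudo_poly d \<alpha> \<theta>" and "x \<ge> 1"
  shows "0 \<le> pp_eval d \<alpha> \<theta> x" "pp_eval d \<alpha> \<theta> x \<le> (\<Sum>i=1..d. \<alpha> i) * x powr \<theta> d"
proof -
  have coeff_nonneg: "0 \<le> \<alpha> i" if "i \<in> {1..d}" for i
    using pp that by (auto simp: pseudo_poly_def intro: less_imp_le)
  then show "0 \<le> pp_eval d \<alpha> \<theta> x"
    unfolding pp_eval_def by (intro sum_nonneg mult_nonneg_nonneg) auto
  show "pp_eval d \<alpha> \<theta> x \<le> (\<Sum>i=1..d. \<alpha> i) * x powr \<theta> d"
    unfolding pp_eval_def sum_distrib_right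
    using coeff_nonneg \<open>x \<ge> 1\<close> pseudo_poly_exponent_le_top[OF pp]
    by (intro sum_mono mult_left_mono powr_mono) auto
qed

lemma pseudo_poly_power_saving:
  assumes pp: "pseudo_poly d \<alpha> \<theta>"
  shows "\<exists>\<sigma>>0. \<sigma> < 1 \<and> power_saving (\<lambda>n. pp_eval d \<alpha> \<theta> (real n)) \<sigma>"
proof -
  note ge_1 = pseudo_poly_exponent_ge_1[OF pp] and le_top = pseudo_poly_exponent_le_top[OF pp]
  define I where "I = {i \<in> {1..d}. \<theta> i \<notin> \<int>}"
  have I_finite: "finite I" "I \<noteq> {}" using pp by (auto simp: I_def pseudo_poly_def)
  define m where "m = Max I"
  have "m \<in> I" unfolding m_def using I_finite by (rule Max_in)
  then have m_nonint: "m \<in> {1..d}" "\<theta> m \<notin> \<int>" by (auto simp: I_def)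
  have top: "\<theta> i < \<theta> m" if "i \<in> {1..d}" "i \<noteq> m" "\<theta> i \<notin> \<int>" for i
  proof -
    have "i \<le> m" unfolding m_def using I_finite that by (intro Max_ge) (auto simp: I_def)
    then show ?thesis using pseudo_poly_exponent_less[OF pp] m_nonint that by simp
  qed
  have theta: "pp_deriv d \<alpha> \<theta> k \<in> \<Theta>(\<lambda>x. x powr (\<theta> m - real k))" if "\<theta> d < real k" for k
  proof (rule pp_deriv_bigtheta)
    have "\<alpha> m > 0" using m_nonint pp by (simp add: pseudo_poly_def)
    then show "\<alpha> m \<noteq> 0" by simp
    show "\<theta> i < \<theta> m" if "i \<in> {1..d}" "i \<noteq> m" "\<theta> i \<notin> \<int>" for i
      using that by (rule top)
    show "0 \<le> \<theta> i \<and> \<theta> i < real k" if "i \<in> {1..d}" for i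
      using ge_1[OF that] le_top[OF that] \<open>\<theta> d < real k\<close> by linarith
  qed (use m_nonint in auto)
  define k where "k = nat \<lceil>2 * \<theta> d\<rceil>"
  have k_large: "2 * \<theta> d < real (Suc k)" unfolding k_def by linarith
  have "1 \<le> \<theta> m" "\<theta> m \<le> \<theta> d" using ge_1 le_top m_nonint by auto
  then show ?thesis
    unfolding pp_deriv_0[symmetric] using k_large
    by (intro power_saving_if_bigtheta_derivatives[of _ "\<theta> m" k] has_real_derivative_pp_deriv
        theta bigthetaD1) auto
qed

section \<open>Values close to integers\<close>

lemma ex_dvd_floor:
  fixes f :: "'a \<Rightarrow> real" and b :: nat
  assumes S_finite: "finite S" "S \<noteq> {}" and "b > 0"
    and small: "\<And>c::int. c \<noteq> 0 \<Longrightarrow> \<bar>c\<bar> < 4 * (int b)\<^sup>2 \<Longrightarrow>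
      norm (\<Sum>n\<in>S. cis2pi (of_int c / real b * f n)) \<le> real (card S) / (8 * (real b)\<^sup>2)"
  shows "\<exists>n\<in>S. int b dvd \<lfloor>f n\<rfloor>"
proof -
  define \<delta> where "\<delta> = 1 / (2 * real b)"
  have "exp_sums_small S (UNIV :: unit set) (4 * b\<^sup>2) (\<lambda>n _. f n / real b)"
    unfolding exp_sums_small_def using small by (simp add: UNIV_unit)
  then obtain n where "n \<in> S"
    and near: "dist_nint (f n / real b - \<delta>) <
      sqrt (real (card (UNIV :: unit set)) / real (4 * b\<^sup>2))"
    using ex_all_dist_nint_less[of S "UNIV :: unit set" "4 * b\<^sup>2" _ "\<lambda>_. \<delta>"] S_finite \<open>b > 0\<close>
    by fastforce
  note near
  also have "sqrt (real (card (UNIV :: unit set)) / real (4 * b\<^sup>2)) = \<delta>"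
    by (simp add: \<delta>_def real_sqrt_divide real_sqrt_mult)
  finally have "frac (f n / real b) < 2 * \<delta>"
    using \<open>b > 0\<close> by (intro frac_less_if_dist_nint_diff_less) (auto simp: \<delta>_def)
  then have "int b dvd \<lfloor>f n\<rfloor>"
    using \<open>b > 0\<close> by (intro dvd_floor_if_frac_divide_less) (auto simp: \<delta>_def)
  with \<open>n \<in> S\<close> show ?thesis by blast
qed

text \<open>If \<open>f n\<close> is slightly above an integer, then \<open>\<xi> * of_int \<lfloor>f n\<rfloor>\<close> is close to \<open>\<xi> * f n\<close>.\<close>
lemma ex_dist_nint_mult_floor_le:
  fixes f :: "'a \<Rightarrow> real"
  assumes S_finite: "finite S" "S \<noteq> {}" and "8 \<le> H" and \<xi>_le: "\<bar>\<xi>\<bar> \<le> 1"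
    and small: "\<And>b c::int. (b, c) \<noteq> (0, 0) \<Longrightarrow> \<bar>b\<bar> < int H \<Longrightarrow> \<bar>c\<bar> < int H \<Longrightarrow>
      norm (\<Sum>n\<in>S. cis2pi ((of_int b + of_int c * \<xi>) * f n)) \<le> real (card S) / (2 * (real H)\<^sup>2)"
  shows "\<exists>n\<in>S. dist_nint (\<xi> * of_int \<lfloor>f n\<rfloor>) \<le> 3 * sqrt (2 / real H)"
proof -
  define \<delta> where "\<delta> = sqrt (2 / real H)"
  have "2 / real H \<le> (1 / 2)\<^sup>2" using \<open>8 \<le> H\<close> by (simp add: power2_eq_square field_simps)
  then have "\<delta> \<le> 1 / 2" unfolding \<delta>_def by (rule real_le_lsqrt[rotated -1]) auto
  have "exp_sums_small S (UNIV :: bool set) H (\<lambda>n i. if i then \<xi> * f n else f n)"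
    unfolding exp_sums_small_def
  proof (intro allI impI)
    fix c :: "bool \<Rightarrow> int" assume "\<exists>i\<in>UNIV. c i \<noteq> 0" "\<forall>i\<in>UNIV. \<bar>c i\<bar> < int H"
    then have "norm (\<Sum>n\<in>S. cis2pi ((of_int (c False) + of_int (c True) * \<xi>) * f n)) \<le>
        real (card S) / (2 * (real H)\<^sup>2)"
      by (intro small) (auto simp: ex_bool_eq)
    then show "norm (\<Sum>n\<in>S. cis2pi (\<Sum>i\<in>UNIV. of_int (c i) * (if i then \<xi> * f n else f n))) \<le>
        real (card S) / (2 * real H ^ card (UNIV :: bool set))"
      by (simp add: UNIV_bool algebra_simps power2_eq_square)
  qed
  from ex_all_dist_nint_less[OF S_finite _ _ this, of "\<lambda>i. if i then 0 else \<delta>"]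
  obtain n where n_near: "n \<in> S" "dist_nint (\<xi> * f n) < \<delta>" "dist_nint (f n - \<delta>) < \<delta>"
    using \<open>8 \<le> H\<close> by (auto simp: UNIV_bool \<delta>_def)
  then have "frac (f n) < 2 * \<delta>"
    using \<open>\<delta> \<le> 1 / 2\<close> by (intro frac_less_if_dist_nint_diff_less)
  then have "\<bar>- \<xi> * frac (f n)\<bar> \<le> 1 * (2 * \<delta>)"
    unfolding abs_mult using \<xi>_le by (intro mult_mono) auto
  moreover have "\<xi> * of_int \<lfloor>f n\<rfloor> = \<xi> * f n + - \<xi> * frac (f n)"
    by (simp add: frac_def algebra_simps)
  ultimately have "dist_nint (\<xi> * of_int \<lfloor>f n\<rfloor>) \<le> 3 * \<delta>"
    using dist_nint_add_le[of "\<xi> * f n" "- \<xi> * frac (f n)"] n_near(2) by simp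
  with n_near(1) show ?thesis unfolding \<delta>_def by blast
qed

lemma power_saving_eventually_ex_dvd_floor:
  assumes saving: "power_saving f \<sigma>"
  shows "\<forall>\<^sub>F N in sequentially. \<forall>b::nat. b > 0 \<longrightarrow> 8 * (real b)\<^sup>2 \<le> real N powr \<sigma> \<longrightarrow>
    (\<exists>n\<in>{N..<2*N}. int b dvd \<lfloor>f n\<rfloor>)"
  using saving[unfolded power_saving_def] eventually_gt_at_top[of 0]
proof eventually_elim
  case (elim N)
  show ?case
  proof (intro allI impI ex_dvd_floor)
    fix b :: nat and c :: int
    assume b_bounds: "b > 0" "8 * (real b)\<^sup>2 \<le> real N powr \<sigma>"
      and c_bounds: "c \<noteq> 0" "\<bar>c\<bar> < 4 * (int b)\<^sup>2"
    have "real b \<le> (real b)\<^sup>2" using b_bounds by (simp add: power2_eq_square)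
    then have "real b \<le> real N powr \<sigma>" using b_bounds by linarith
    then have "real N powr (- \<sigma>) \<le> 1 / real b"
      using b_bounds elim by (simp add: powr_minus_divide frac_le)
    also have "\<dots> \<le> \<bar>of_int c / real b\<bar>"
      using c_bounds by (simp add: abs_divide divide_right_mono)
    finally have "real N powr (- \<sigma>) \<le> \<bar>of_int c / real b\<bar>" .
    moreover have "\<bar>of_int c / real b\<bar> \<le> real N powr \<sigma>"
    proof -
      have "real_of_int \<bar>c\<bar> \<le> real_of_int (4 * (int b)\<^sup>2)"
        using c_bounds unfolding of_int_le_iff by simp
      then have "\<bar>real_of_int c\<bar> \<le> 4 * (real b)\<^sup>2" by simp
      moreover have "\<bar>of_int c / real b\<bar> \<le> \<bar>real_of_int c\<bar> / 1"
        unfolding abs_divide using b_bounds by (intro divide_left_mono) auto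
      ultimately show ?thesis using b_bounds by linarith
    qed
    ultimately have "norm (\<Sum>n=N..<2*N. cis2pi (of_int c / real b * f n)) \<le> real N powr (1 - \<sigma>)"
      using elim by blast
    also have "\<dots> = real N / real N powr \<sigma>"
      using elim by (simp add: powr_diff)
    also have "\<dots> \<le> real N / (8 * (real b)\<^sup>2)"
      using b_bounds elim by (intro divide_left_mono) auto
    finally show "norm (\<Sum>n=N..<2*N. cis2pi (of_int c / real b * f n)) \<le>
        real (card {N..<2*N}) / (8 * (real b)\<^sup>2)" by simp
  qed (use elim in auto)
qed

lemma abs_of_int_add_of_int_mult_ge:
  fixes H :: nat
  assumes far: "\<And>b::nat. 0 < b \<Longrightarrow> b < H \<Longrightarrow> \<delta> \<le> dist_nint (\<xi> * real b)" and "\<delta> \<le> 1"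
    and coeffs: "(b, c) \<noteq> (0, 0)" "\<bar>c\<bar> < int H"
  shows "\<delta> \<le> \<bar>of_int b + of_int c * \<xi>\<bar>"
proof (cases "c = 0")
  case True
  then have "1 \<le> \<bar>real_of_int b\<bar>" using coeffs by simp
  then show ?thesis using \<open>\<delta> \<le> 1\<close> True by simp
next
  case False
  have "\<delta> \<le> dist_nint (\<xi> * of_int \<bar>c\<bar>)"
    using far[of "nat \<bar>c\<bar>"] coeffs False by simp
  also have "\<dots> \<le> \<bar>\<xi> * of_int \<bar>c\<bar> - of_int (- sgn c * b)\<bar>"
    by (rule dist_nint_le)
  also have "\<dots> = \<bar>of_int b + of_int c * \<xi>\<bar>"
    using False by (cases "c > 0") (auto simp: algebra_simps abs_minus_commute)
  finally show ?thesis .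
qed

lemma power_saving_eventually_ex_dist_nint_mult_floor_le:
  assumes saving: "power_saving f \<sigma>" and "\<sigma> \<ge> 0"
  shows "\<forall>\<^sub>F N in sequentially. \<forall>\<xi> H. 8 \<le> H \<longrightarrow> 2 * (real H)\<^sup>2 \<le> real N powr \<sigma> \<longrightarrow>
    (\<forall>b::nat. 0 < b \<longrightarrow> b < H \<longrightarrow> real N powr (- \<sigma>) \<le> dist_nint (\<xi> * real b)) \<longrightarrow>
    (\<exists>n\<in>{N..<2*N}. dist_nint (\<xi> * of_int \<lfloor>f n\<rfloor>) \<le> 3 * sqrt (2 / real H))"
  using saving[unfolded power_saving_def] eventually_gt_at_top[of 0]
proof eventually_elim
  case (elim N)
  show ?case
  proof (intro allI impI)
    fix \<xi> H assume H_bounds: "8 \<le> H" "2 * (real H)\<^sup>2 \<le> real N powr \<sigma>"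
      and far: "\<forall>b::nat. 0 < b \<longrightarrow> b < H \<longrightarrow> real N powr (- \<sigma>) \<le> dist_nint (\<xi> * real b)"
    have far_frac: "real N powr (- \<sigma>) \<le> dist_nint (frac \<xi> * real b)" if "0 < b" "b < H" for b
      using far that dist_nint_frac_mult_of_int[of \<xi> "int b"] by simp
    have "real N powr (- \<sigma>) \<le> real N powr 0"
      using elim assms(2) by (intro powr_mono) auto
    then have le_1: "real N powr (- \<sigma>) \<le> 1" using elim by simp
    have "\<exists>n\<in>{N..<2*N}. dist_nint (frac \<xi> * of_int \<lfloor>f n\<rfloor>) \<le> 3 * sqrt (2 / real H)"
    proof (rule ex_dist_nint_mult_floor_le)
      fix b c :: int assume coeffs: "(b, c) \<noteq> (0, 0)" "\<bar>b\<bar> < int H" "\<bar>c\<bar> < int H"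
      have "\<bar>of_int b + of_int c * frac \<xi>\<bar> \<le> \<bar>real_of_int b\<bar> + \<bar>real_of_int c\<bar> * 1"
        by (intro order_trans[OF abs_triangle_ineq] add_left_mono)
          (simp add: abs_mult mult_left_le frac_lt_1 less_imp_le)
      also have "\<dots> \<le> 2 * real H" using coeffs by linarith
      also have "\<dots> \<le> 2 * (real H)\<^sup>2" using H_bounds by (simp add: power2_eq_square)
      also have "\<dots> \<le> real N powr \<sigma>" by (rule H_bounds)
      finally have "norm (\<Sum>n=N..<2*N. cis2pi ((of_int b + of_int c * frac \<xi>) * f n)) \<le>
          real N powr (1 - \<sigma>)"
        using abs_of_int_add_of_int_mult_ge[OF far_frac le_1 coeffs(1,3)] elim by blast
      also have "\<dots> = real N / real N powr \<sigma>"
        using elim by (simp add: powr_diff)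
      also have "\<dots> \<le> real N / (2 * (real H)\<^sup>2)"
        using H_bounds elim by (intro divide_left_mono) auto
      finally show "norm (\<Sum>n=N..<2*N. cis2pi ((of_int b + of_int c * frac \<xi>) * f n)) \<le>
          real (card {N..<2*N}) / (2 * (real H)\<^sup>2)" by simp
    qed (use elim H_bounds in \<open>auto simp: frac_lt_1 less_imp_le\<close>)
    then show "\<exists>n\<in>{N..<2*N}. dist_nint (\<xi> * of_int \<lfloor>f n\<rfloor>) \<le> 3 * sqrt (2 / real H)"
      by (simp add: dist_nint_frac_mult_of_int)
  qed
qed

lemma dist_nint_mult_floor_le_if_dvd:
  fixes b :: nat
  assumes "int b dvd \<lfloor>x\<rfloor>" "b > 0" "0 \<le> x"
  shows "dist_nint (\<xi> * of_int \<lfloor>x\<rfloor>) \<le> dist_nint (\<xi> * real b) * x"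
proof -
  obtain q where floor_eq: "\<lfloor>x\<rfloor> = int b * q" using assms(1) by blast
  have "\<bar>real_of_int q\<bar> \<le> real b * \<bar>real_of_int q\<bar>"
    using assms(2) by (simp add: mult_le_cancel_right1)
  also have "\<dots> = \<bar>real_of_int \<lfloor>x\<rfloor>\<bar>" by (simp add: floor_eq abs_mult)
  also have "\<dots> \<le> x" using assms(3) by simp
  finally have "dist_nint (\<xi> * real b) * \<bar>real_of_int q\<bar> \<le> dist_nint (\<xi> * real b) * x"
    by (intro mult_left_mono dist_nint_nonneg)
  then show ?thesis
    using dist_nint_mult_of_int_le[of "\<xi> * real b" q] by (simp add: floor_eq mult.assoc)
qed

lemma power_saving_eventually_ex_dist_nint_mult_floor_le_max:
  assumes saving: "power_saving f \<sigma>" and nonneg: "\<sigma> \<ge> 0" "A \<ge> 0" "T \<ge> 0"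
    and growth: "\<And>n. n > 0 \<Longrightarrow> 0 \<le> f n" "\<And>n. n > 0 \<Longrightarrow> f n \<le> A * real n powr T"
  shows "\<forall>\<^sub>F L in sequentially. \<forall>M H \<xi>. L \<le> M \<longrightarrow> 8 \<le> H \<longrightarrow> 8 * (real H)\<^sup>2 \<le> real L powr \<sigma> \<longrightarrow>
    (\<exists>n\<in>{L..<2*M}. dist_nint (\<xi> * of_int \<lfloor>f n\<rfloor>) \<le>
      max (3 * sqrt (2 / real H)) (A * (2 * real L) powr T * real M powr (- \<sigma>)))"
  using power_saving_eventually_ex_dvd_floor[OF saving] eventually_gt_at_top[of 0]
    eventually_all_ge_at_top[OF
      power_saving_eventually_ex_dist_nint_mult_floor_le[OF saving nonneg(1)]]
proof eventually_elim
  case (elim L)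
  show ?case
  proof (intro allI impI)
    fix M H \<xi> assume "L \<le> M" and H_bounds: "8 \<le> H" "8 * (real H)\<^sup>2 \<le> real L powr \<sigma>"
    show "\<exists>n\<in>{L..<2*M}. dist_nint (\<xi> * of_int \<lfloor>f n\<rfloor>) \<le>
      max (3 * sqrt (2 / real H)) (A * (2 * real L) powr T * real M powr (- \<sigma>))"
    proof (cases "\<forall>b::nat. 0 < b \<longrightarrow> b < H \<longrightarrow> real M powr (- \<sigma>) \<le> dist_nint (\<xi> * real b)")
      case True
      have "real L powr \<sigma> \<le> real M powr \<sigma>"
        using \<open>L \<le> M\<close> nonneg(1) by (intro powr_mono2) auto
      moreover have "0 \<le> (real H)\<^sup>2" by simp
      ultimately have "2 * (real H)\<^sup>2 \<le> real M powr \<sigma>" using H_bounds by linarith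
      then obtain n where "n \<in> {M..<2*M}" "dist_nint (\<xi> * of_int \<lfloor>f n\<rfloor>) \<le> 3 * sqrt (2 / real H)"
        using elim(3) \<open>L \<le> M\<close> H_bounds(1) True by blast
      then show ?thesis using \<open>L \<le> M\<close> by (intro bexI[of _ n]) auto
    next
      case False
      then obtain b :: nat where b_bounds: "0 < b" "b < H"
        and near: "dist_nint (\<xi> * real b) \<le> real M powr (- \<sigma>)"
        by (auto simp: not_le)
      have "8 * (real b)\<^sup>2 \<le> 8 * (real H)\<^sup>2"
        using b_bounds by (intro mult_left_mono power_mono) auto
      then obtain n where n_range: "n \<in> {L..<2*L}" and dvd: "int b dvd \<lfloor>f n\<rfloor>"
        using elim(1) b_bounds H_bounds by (meson order_trans)
      have "n > 0" using n_range elim(2) by simp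
      have "f n \<le> A * real n powr T" by (rule growth(2)[OF \<open>n > 0\<close>])
      also have "\<dots> \<le> A * (2 * real L) powr T"
        using n_range nonneg by (intro mult_left_mono powr_mono2) auto
      finally have "dist_nint (\<xi> * real b) * f n \<le> real M powr (- \<sigma>) * (A * (2 * real L) powr T)"
        using near growth(1)[OF \<open>n > 0\<close>] by (intro mult_mono) auto
      then have "dist_nint (\<xi> * of_int \<lfloor>f n\<rfloor>) \<le> A * (2 * real L) powr T * real M powr (- \<sigma>)"
        using dist_nint_mult_floor_le_if_dvd[OF dvd b_bounds(1) growth(1)[OF \<open>n > 0\<close>], of \<xi>]
        by (simp add: mult_ac)
      then show ?thesis using n_range \<open>L \<le> M\<close> by (intro bexI[of _ n]) auto
    qed
  qed
qed

text \<open>The exponents balance the three errors: \<open>H\<close> is as large as the moduli treated at scale \<open>L\<close>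
  allow, and \<open>L powr T\<close> is only the square root of the gain \<open>N powr \<sigma>\<close>.\<close>
lemma balanced_parameters:
  fixes N :: nat and \<rho> \<eta> T \<sigma> :: real
  defines "L \<equiv> nat \<lceil>real N powr \<rho>\<rceil>" and "H \<equiv> nat \<lceil>real N powr (2 * \<eta>)\<rceil>"
  assumes N_large: "1 \<le> N" "8 \<le> real N powr (2 * \<eta>)" and "0 \<le> T" "0 \<le> \<sigma>"
    and \<rho>_balance: "0 \<le> \<rho>" "\<rho> \<le> 1" "\<rho> * T = \<sigma> / 2" and \<eta>_balance: "\<rho> * \<sigma> = 8 * \<eta>" "\<eta> \<le> \<sigma> / 2"
  shows "1 \<le> L" "L \<le> N" "8 \<le> H" "8 * (real H)\<^sup>2 \<le> real L powr \<sigma>"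
    and "3 * sqrt (2 / real H) \<le> 6 * real N powr (- \<eta>)"
    and "(2 * real L) powr T * real N powr (- \<sigma>) \<le> 4 powr T * real N powr (- \<eta>)"
proof -
  have H_bounds: "real N powr (2 * \<eta>) \<le> real H" "real H \<le> 2 * real N powr (2 * \<eta>)"
    using N_large(2) unfolding H_def by linarith+
  then show "8 \<le> H" using N_large(2) by linarith
  have "1 \<le> real N powr \<rho>" using N_large(1) \<rho>_balance(1) by (simp add: ge_one_powr_ge_zero)
  then have L_bounds: "real N powr \<rho> \<le> real L" "real L \<le> 2 * real N powr \<rho>"
    unfolding L_def by linarith+
  then show "1 \<le> L" using \<open>1 \<le> real N powr \<rho>\<close> by linarith
  have "real N powr \<rho> \<le> real N"
    using N_large(1) \<rho>_balance(2) powr_mono[of \<rho> 1 "real N"] by simp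
  then show "L \<le> N" unfolding L_def by linarith
  have "8 * (real H)\<^sup>2 \<le> 8 * (2 * real N powr (2 * \<eta>))\<^sup>2"
    using H_bounds by (intro mult_left_mono power_mono) auto
  also have "\<dots> = 32 * real N powr (4 * \<eta>)"
    by (simp add: power2_eq_square flip: powr_add)
  also have "\<dots> \<le> (real N powr (2 * \<eta>))\<^sup>2 * real N powr (4 * \<eta>)"
    using mult_mono[OF N_large(2) N_large(2)]
    by (intro mult_right_mono) (auto simp: power2_eq_square)
  also have "\<dots> = (real N powr \<rho>) powr \<sigma>"
    by (simp add: powr_powr \<eta>_balance(1) power2_eq_square flip: powr_add)
  also have "\<dots> \<le> real L powr \<sigma>"
    using L_bounds \<open>0 \<le> \<sigma>\<close> by (intro powr_mono2) auto
  finally show "8 * (real H)\<^sup>2 \<le> real L powr \<sigma>" .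
  have "2 / real H \<le> 4 / real N powr (2 * \<eta>)"
    using H_bounds N_large by (intro frac_le) auto
  also have "\<dots> = (2 * real N powr (- \<eta>))\<^sup>2"
    by (simp add: power2_eq_square powr_minus_divide flip: powr_add)
  finally show "3 * sqrt (2 / real H) \<le> 6 * real N powr (- \<eta>)"
    using real_le_lsqrt[of "2 * real N powr (- \<eta>)" "2 / real H"] by simp
  have "(2 * real L) powr T * real N powr (- \<sigma>) \<le> (4 * real N powr \<rho>) powr T * real N powr (- \<sigma>)"
    using L_bounds \<open>1 \<le> real N powr \<rho>\<close> \<open>0 \<le> T\<close> by (intro mult_right_mono powr_mono2) auto
  also have "\<dots> = 4 powr T * real N powr (- (\<sigma> / 2))"
    by (simp add: powr_mult powr_powr \<rho>_balance(3) flip: powr_add)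
  also have "\<dots> \<le> 4 powr T * real N powr (- \<eta>)"
    using N_large(1) \<eta>_balance(2) by (intro mult_left_mono powr_mono) auto
  finally show "(2 * real L) powr T * real N powr (- \<sigma>) \<le> 4 powr T * real N powr (- \<eta>)" .
qed

lemma power_saving_eventually_ex_dist_nint_mult_floor_le_powr:
  assumes saving: "power_saving f \<sigma>" and nonneg: "\<sigma> \<ge> 0" "A \<ge> 0" "T \<ge> 0"
    and growth: "\<And>n. n > 0 \<Longrightarrow> 0 \<le> f n" "\<And>n. n > 0 \<Longrightarrow> f n \<le> A * real n powr T"
    and \<rho>_balance: "0 < \<rho>" "\<rho> \<le> 1" "\<rho> * T = \<sigma> / 2"
    and \<eta>_balance: "0 < \<eta>" "\<rho> * \<sigma> = 8 * \<eta>" "\<eta> \<le> \<sigma> / 2"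
  shows "\<forall>\<^sub>F N in sequentially. \<forall>\<xi>. \<exists>n\<in>{1..<2*N}.
    dist_nint (\<xi> * of_int \<lfloor>f n\<rfloor>) \<le> max 6 (A * 4 powr T) * real N powr (- \<eta>)"
proof -
  define L H where "L N = nat \<lceil>real N powr \<rho>\<rceil>" and "H N = nat \<lceil>real N powr (2 * \<eta>)\<rceil>" for N
  have "filterlim L at_top sequentially"
    unfolding L_def using \<rho>_balance by real_asymp
  with power_saving_eventually_ex_dist_nint_mult_floor_le_max[OF saving nonneg growth]
  have "\<forall>\<^sub>F N in sequentially. \<forall>M H \<xi>. L N \<le> M \<longrightarrow> 8 \<le> H \<longrightarrow>
      8 * (real H)\<^sup>2 \<le> real (L N) powr \<sigma> \<longrightarrow> (\<exists>n\<in>{L N..<2*M}. dist_nint (\<xi> * of_int \<lfloor>f n\<rfloor>) \<le>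
        max (3 * sqrt (2 / real H)) (A * (2 * real (L N)) powr T * real M powr (- \<sigma>)))"
    by (rule eventually_compose_filterlim)
  moreover have "\<forall>\<^sub>F N in sequentially. 8 \<le> real N powr (2 * \<eta>)"
    using \<eta>_balance by real_asymp
  ultimately show ?thesis
    using eventually_ge_at_top[of 1]
  proof eventually_elim
    case (elim N)
    note parameters = balanced_parameters[OF elim(3,2) nonneg(3,1) less_imp_le[OF \<rho>_balance(1)]
        \<rho>_balance(2,3) \<eta>_balance(2,3), folded L_def H_def]
    show ?case
    proof
      fix \<xi>
      obtain n where n_range: "n \<in> {L N..<2*N}" and "dist_nint (\<xi> * of_int \<lfloor>f n\<rfloor>) \<le>
          max (3 * sqrt (2 / real (H N))) (A * (2 * real (L N)) powr T * real N powr (- \<sigma>))"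
        using elim(1) parameters(2-4) by blast
      note this(2)
      also have "\<dots> \<le> max (6 * real N powr (- \<eta>)) (A * (4 powr T * real N powr (- \<eta>)))"
        using parameters(5,6) nonneg(2) by (intro max.mono) (auto simp: mult.assoc mult_left_mono)
      also have "\<dots> = max 6 (A * 4 powr T) * real N powr (- \<eta>)"
        by (simp add: max_mult_distrib_right mult.assoc)
      finally show "\<exists>n\<in>{1..<2*N}. dist_nint (\<xi> * of_int \<lfloor>f n\<rfloor>) \<le>
          max 6 (A * 4 powr T) * real N powr (- \<eta>)"
        using n_range parameters(1) by (intro bexI[of _ n]) auto
    qed
  qed
qed

lemma eventually_le_powr_of_twice:
  assumes "\<eta> \<ge> 0" "C \<ge> 0"
    and eventually_twice: "\<forall>\<^sub>F N in sequentially. \<forall>\<xi>. \<exists>n\<in>{1..<2*N}. g \<xi> n \<le> C * real N powr (- \<eta>)"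
  shows "\<forall>\<^sub>F N in sequentially. \<forall>\<xi>. \<exists>n\<in>{1..N}. g \<xi> n \<le> C * 4 powr \<eta> * real N powr (- \<eta>)"
proof -
  have "filterlim (\<lambda>N::nat. N div 2) sequentially sequentially"
    by (rule filterlim_at_top_div_const_nat) simp
  from eventually_compose_filterlim[OF eventually_twice this] eventually_ge_at_top[of 2]
  show ?thesis
  proof eventually_elim
    case (elim N)
    show ?case
    proof
      fix \<xi>
      obtain n where n_bound: "n \<in> {1..<2 * (N div 2)}" "g \<xi> n \<le> C * real (N div 2) powr (- \<eta>)"
        using elim(1) by blast
      have "real N / 4 \<le> real (N div 2)" using elim(2) by linarith
      then have "real (N div 2) powr (- \<eta>) \<le> (real N / 4) powr (- \<eta>)"
        using elim(2) assms by (intro powr_mono2') auto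
      also have "\<dots> = 4 powr \<eta> * real N powr (- \<eta>)"
        by (simp add: powr_divide powr_minus field_simps)
      finally have "C * real (N div 2) powr (- \<eta>) \<le> C * 4 powr \<eta> * real N powr (- \<eta>)"
        using assms(2) by (simp add: mult.assoc mult_left_mono)
      with n_bound show "\<exists>n\<in>{1..N}. g \<xi> n \<le> C * 4 powr \<eta> * real N powr (- \<eta>)"
        by (intro bexI[of _ n]) auto
    qed
  qed
qed

lemma power_saving_imp_ex_dist_nint_mult_floor_le_powr:
  assumes saving: "power_saving f \<sigma>" and \<sigma>_bounds: "0 < \<sigma>" "\<sigma> < 1"
    and A_nonneg: "A \<ge> 0" and T_ge_1: "T \<ge> 1"
    and growth: "\<And>n. n > 0 \<Longrightarrow> 0 \<le> f n" "\<And>n. n > 0 \<Longrightarrow> f n \<le> A * real n powr T"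
  shows "\<exists>\<eta>>0. \<exists>C>0. \<forall>\<^sub>F N in sequentially. \<forall>\<xi>.
    \<exists>n\<in>{1..N}. dist_nint (\<xi> * of_int \<lfloor>f n\<rfloor>) \<le> C * real N powr (- \<eta>)"
proof -
  define \<rho> where "\<rho> = \<sigma> / (2 * T)"
  define \<eta> where "\<eta> = \<rho> * \<sigma> / 8"
  define C where "C = max 6 (A * 4 powr T)"
  have \<rho>_balance: "0 < \<rho>" "\<rho> \<le> 1" "\<rho> * T = \<sigma> / 2"
    using \<sigma>_bounds T_ge_1 by (auto simp: \<rho>_def field_simps)
  have "\<rho> * \<sigma> \<le> \<sigma>" using \<rho>_balance \<sigma>_bounds by simp
  then have \<eta>_balance: "0 < \<eta>" "\<rho> * \<sigma> = 8 * \<eta>" "\<eta> \<le> \<sigma> / 2"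
    using \<rho>_balance \<sigma>_bounds by (auto simp: \<eta>_def)
  have "\<forall>\<^sub>F N in sequentially. \<forall>\<xi>. \<exists>n\<in>{1..<2*N}.
      dist_nint (\<xi> * of_int \<lfloor>f n\<rfloor>) \<le> C * real N powr (- \<eta>)"
    unfolding C_def using \<sigma>_bounds A_nonneg T_ge_1 growth \<rho>_balance \<eta>_balance
    by (intro power_saving_eventually_ex_dist_nint_mult_floor_le_powr[OF saving]) auto
  moreover have "C > 0" by (simp add: C_def)
  ultimately have "\<forall>\<^sub>F N in sequentially. \<forall>\<xi>. \<exists>n\<in>{1..N}.
      dist_nint (\<xi> * of_int \<lfloor>f n\<rfloor>) \<le> C * 4 powr \<eta> * real N powr (- \<eta>)"
    using \<eta>_balance
    by (intro eventually_le_powr_of_twice[where g = "\<lambda>\<xi> n. dist_nint (\<xi> * of_int \<lfloor>f n\<rfloor>)"]) auto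
  with \<open>C > 0\<close> \<eta>_balance show ?thesis
    by (intro exI[of _ \<eta>] conjI exI[of _ "C * 4 powr \<eta>"]) auto
qed

theorem theorem2p6:
  fixes d :: nat and \<alpha> \<theta> :: "nat \<Rightarrow> real"
  assumes "pseudo_poly d \<alpha> \<theta>"
  shows "\<exists>\<eta>>0. \<exists>C>0. \<forall>\<xi>::real. \<forall>\<^sub>F N in sequentially.
           (MIN n\<in>{1..N}. dist_nint (\<xi> * of_int \<lfloor>pp_eval d \<alpha> \<theta> (real n)\<rfloor>))
             \<le> C * real N powr (-\<eta>)"
proof -
  let ?g = "\<lambda>\<xi> n. dist_nint (\<xi> * of_int \<lfloor>pp_eval d \<alpha> \<theta> (real n)\<rfloor>)"
  obtain \<sigma> where \<sigma>_bounds: "0 < \<sigma>" "\<sigma> < 1" and saving: "power_saving (\<lambda>n. pp_eval d \<alpha> \<theta> (real n)) \<sigma>"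
    using pseudo_poly_power_saving[OF assms] by blast
  have "\<theta> d \<ge> 1"
    using assms by (intro pseudo_poly_exponent_ge_1) (auto simp: pseudo_poly_def)
  moreover have "(\<Sum>i=1..d. \<alpha> i) \<ge> 0"
    using assms by (intro sum_nonneg) (simp add: pseudo_poly_def less_imp_le)
  ultimately have "\<exists>\<eta>>0. \<exists>C>0. \<forall>\<^sub>F N in sequentially. \<forall>\<xi>. \<exists>n\<in>{1..N}. ?g \<xi> n \<le> C * real N powr (- \<eta>)"
    using pp_eval_bounds[OF assms]
    by (intro power_saving_imp_ex_dist_nint_mult_floor_le_powr[OF saving \<sigma>_bounds]) auto
  then obtain \<eta> C where "\<eta> > 0" "C > 0"
    and near: "\<forall>\<^sub>F N in sequentially. \<forall>\<xi>. \<exists>n\<in>{1..N}. ?g \<xi> n \<le> C * real N powr (- \<eta>)"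
    by blast
  have "\<forall>\<^sub>F N in sequentially. (MIN n\<in>{1..N}. ?g \<xi> n) \<le> C * real N powr (- \<eta>)" for \<xi>
    using near by eventually_elim (force simp: Min_le_iff)
  with \<open>\<eta> > 0\<close> \<open>C > 0\<close> show ?thesis by blast
qed

end
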